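(* Let $\boldsymbol{\Phi}=\{\Phi_k\}_{k\ge1}$ be a non-autonomous conformal iterated function system (NCIFS) in $\mathbb{R}^d$ satisfying $\lim_{k\to\infty}\frac{\log \underline c_k}{\log M_k}=0$, and let $\mu$ be a positive finite Borel measure on $\Sigma^\infty$ with image measure $\mu^\omega$. Then for all $q>0$, $$\underline{D}_q(\mu^\omega)\le\min\{\underline{d}_q^*, d\},\qquad \overline{D}_q(\mu^\omega)\le\min\{\overline{d}_q^*, d\}.$$
   Context: Words. $\{I_k\}_{k\ge1}$ is a sequence of finite index sets with $\#I_k\ge 2$. For $1\le l\le k$, $\Sigma_l^k=\{u_l u_{l+1}\ldots u_k: u_j\in I_j\}$, $\Sigma^k=\Sigma_1^k$, $\Sigma^0=\{\emptyset\}$ (empty word), $\Sigma^*=\bigcup_{k\ge0}\Sigma^k$, $\Sigma^\infty=\{u_1u_2\ldots: u_k\in I_k\}$. $|\mathbf u|$ is the length of $\mathbf u$; for $\mathbf u=u_1\ldots u_k$ with $k\ge1$, $\mathbf u^*=u_1\ldots u_{k-1}$; $\mathbf u|_n$ is the prefix of length $n$. $[\mathbf u]=\{\mathbf v\in\Sigma^\infty:\mathbf u\text{ is a prefix of }\mathbf v\}$. $\Sigma^\infty$ has the metric $d(\mathbf u,\mathbf v)=2^{-|\mathbf u\wedge\mathbf v|}$, with $\mathbf u\wedge\mathbf v$ the longest common prefix. NCIFS. $J\subset\mathbb{R}^d$ is compact with non-empty interior and $\overline{\mathrm{int}(J)}=J$; for each $k\ge1$, $\Phi_k=\{\varphi_{k,i}\}_{i\in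 I_k}$ is a family of maps $\varphi_{k,i}:J\to J$. For $\mathbf u=u_l\ldots u_k\in\Sigma_l^k$, $\varphi_{\mathbf u}=\varphi_{l,u_l}\circ\cdots\circ\varphi_{k,u_k}$ ($\varphi_\emptyset$ is the identity). $\boldsymbol\Phi$, together with closed sets $J_{\mathbf u}\subset J$ ($\mathbf u\in\Sigma^*$, $J_\emptyset=J$), is an NCIFS if: (i) there is $0<c<1$ with $|\varphi_{k,i}(x)-\varphi_{k,i}(y)|\le c|x-y|$ for all $k$, $i\in I_k$, $x,y\in J$; (ii) for all $k\ge1$, $\mathbf u\in\Sigma^{k-1}$, $i\in I_k$: $J_{\mathbf ui}\subset J_{\mathbf u}$; (iii) for each $\mathbf u\in\Sigma^*$ there is $\omega_{\mathbf u}\in\mathbb{R}^d$ with $J_{\mathbf u}=\Psi_{\mathbf u}(J)=\varphi_{\mathbf u}(J)+\omega_{\mathbf u}$, where $\Psi_{\mathbf u}=\varphi_{\mathbf u}+\omega_{\mathbf u}$; (iv) there is an open connected set $V\supset J$, independent of $k$, such that each $\varphi_{k,j}$ extends to a $C^1$ conformal diffeomorphism of $V$ into $V$; (v) there is $C\ge1$ with $\|D\varphi_{\mathbf u}(x)\|\le C\|D\varphi_{\mathbf u}(y)\|$ for all $l\le k$, $\mathbf u\in\Sigma_l^k$, $x,y\in V$. Put $\|D\varphi_{\mathbf u}\|=\sup_{x\in J}\|D\varphi_{\mathbf u}(x)\|$, $M_k=\max_{\mathbf u\in\Sigma^k}\|D\varphi_{\mathbf u}\|$, $\underline c_k=\min_{j\in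 I_k}\|D\varphi_{k,j}\|$. The attractor is $E=\bigcap_{k\ge1}\bigcup_{\mathbf u\in\Sigma^k}J_{\mathbf u}$. Image measure. $\pi(\mathbf u)=\bigcap_{n\ge1}J_{\mathbf u|_n}$ (a single point) defines $\pi:\Sigma^\infty\to J$ with $\pi(\Sigma^\infty)=E$, and $\mu^\omega(A)=\mu\{\mathbf u:\pi(\mathbf u)\in A\}$. Generalized $q$-dimensions. For a positive finite Borel measure $\nu$ on $\mathbb{R}^d$, let $\mathcal M_\delta$ be the family of $\delta$-mesh cubes $\prod_{j=1}^d[m_j\delta,(m_j+1)\delta)$, $m_j\in\mathbb{Z}$. For $q\ne1$, $\underline D_q(\nu)$ and $\overline D_q(\nu)$ are the $\liminf$ and $\limsup$ as $\delta\to0$ of $\frac{\log\sum_{Q\in\mathcal M_\delta}\nu(Q)^q}{(q-1)\log\delta}$; for $q=1$ they are the $\liminf$ and $\limsup$ of $\frac{\sum_{Q\in\mathcal M_\delta}\nu(Q)\log\nu(Q)}{\log\delta}$ ($0\log0=0$). Generalized pressures. $\mathcal C(\delta)=\{\mathbf u\in\Sigma^*:\|D\varphi_{\mathbf u}\|\le\delta<\|D\varphi_{\mathbf u^*}\|\}$, $k_\delta=\min\{|\mathbf u|:\mathbf u\in\mathcal C(\delta)\}$. For $t\in\mathbb{R}$, $q>0$, $\overline P_\mu(t,q)$ and $\underline P_\mu(t,q)$ are the $\limsup$ and $\liminf$ as $\delta\to0$ of $\frac{\mathrm{sgn}(1-q)}{k_\delta}\log\sum_{\mathbf u\in\mathcal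 C(\delta)}\|D\varphi_{\mathbf u}\|^{t(1-q)}\mu([\mathbf u])^q$ if $q\ne1$, and of $-\frac1{k_\delta}\sum_{\mathbf u\in\mathcal C(\delta)}\mu([\mathbf u])\log\big(\|D\varphi_{\mathbf u}\|^{-t}\mu([\mathbf u])\big)$ if $q=1$. Their jump points (possibly $\pm\infty$) are $\overline d_q^*=\inf\{t:\overline P_\mu(t,q)<0\}=\sup\{t:\overline P_\mu(t,q)>0\}$ and $\underline d_q^*=\inf\{t:\underline P_\mu(t,q)<0\}=\sup\{t:\underline P_\mu(t,q)>0\}$.
   Formalization: For q = 1 the measure μ is additionally assumed to have total mass at most 1; without this the claim fails, e.g. for twice the uniform measure on the binary system on [0,1], where D_1 = 2 > d = 1. *)

theory Defs
  imports "HOL-Analysis.Analysis"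
begin

section \<open>Words\<close>

text \<open>
  All families are indexed from 1; the values \<open>I 0\<close> and \<open>\<phi> 0\<close> are never used. A word
  \<open>u\<^sub>l \<dots> u\<^sub>k\<close> is the list \<open>[u\<^sub>l, \<dots>, u\<^sub>k]\<close>, so that \<open>words I l k\<close> is \<open>\<Sigma>\<^sub>l\<^sup>k\<close> and \<open>words I 1 0 = {[]}\<close>.
\<close>

definition words :: "(nat \<Rightarrow> 'i set) \<Rightarrow> nat \<Rightarrow> nat \<Rightarrow> 'i list set" where
  "words I l k = {u. length u = Suc k - l \<and> (\<forall>j<length u. u ! j \<in> I (l + j))}"

definition finite_words :: "(nat \<Rightarrow> 'i set) \<Rightarrow> 'i list set" where
  "finite_words I = (\<Union>k. words I 1 k)"

text \<open>Infinite words are extensional functions on \<open>{1..}\<close>.\<close>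

definition inf_words :: "(nat \<Rightarrow> 'i set) \<Rightarrow> (nat \<Rightarrow> 'i) set" where
  "inf_words I = PiE {1..} I"

definition word_prefix :: "(nat \<Rightarrow> 'i) \<Rightarrow> nat \<Rightarrow> 'i list" where
  "word_prefix v n = map v [1..<Suc n]"

definition cylinder :: "(nat \<Rightarrow> 'i set) \<Rightarrow> 'i list \<Rightarrow> (nat \<Rightarrow> 'i) set" where
  "cylinder I u = {v \<in> inf_words I. word_prefix v (length u) = u}"

definition word_dist :: "(nat \<Rightarrow> 'i) \<Rightarrow> (nat \<Rightarrow> 'i) \<Rightarrow> real" where
  "word_dist u v =
     (if u = v then 0 else (1 / 2) ^ (GREATEST n. word_prefix u n = word_prefix v n))"

definition borel_words :: "(nat \<Rightarrow> 'i set) \<Rightarrow> (nat \<Rightarrow> 'i) measure" where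
  "borel_words I =
     sigma (inf_words I) {U. openin (Metric_space.mtopology (inf_words I) word_dist) U}"


section \<open>Non-autonomous conformal iterated function systems\<close>

primrec comp_word :: "(nat \<Rightarrow> 'i \<Rightarrow> 'a \<Rightarrow> 'a) \<Rightarrow> nat \<Rightarrow> 'i list \<Rightarrow> 'a \<Rightarrow> 'a" where
  "comp_word \<phi> l [] = id"
| "comp_word \<phi> l (i # u) = \<phi> l i \<circ> comp_word \<phi> (Suc l) u"

definition deriv_norm :: "('a::euclidean_space \<Rightarrow> 'a) \<Rightarrow> 'a \<Rightarrow> real" where
  "deriv_norm f x = onorm (frechet_derivative f (at x))"

definition sup_deriv_norm :: "'a::euclidean_space set \<Rightarrow> ('a \<Rightarrow> 'a) \<Rightarrow> real" where
  "sup_deriv_norm J f = (SUP x\<in>J. deriv_norm f x)"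

definition C1_on :: "'a::euclidean_space set \<Rightarrow> ('a \<Rightarrow> 'a) \<Rightarrow> bool" where
  "C1_on S f \<longleftrightarrow>
     (\<exists>f'. (\<forall>x\<in>S. (f has_derivative blinfun_apply (f' x)) (at x)) \<and> continuous_on S f')"

text \<open>
  A \<open>C\<^sup>1\<close> diffeomorphism of \<open>V\<close> onto an open subset of \<open>V\<close> is conformal if its derivative at each
  point is a similarity, i.e. a positive multiple of a linear isometry (orientation may be reversed).
\<close>

definition conformal_diffeo_into :: "'a::euclidean_space set \<Rightarrow> ('a \<Rightarrow> 'a) \<Rightarrow> bool" where
  "conformal_diffeo_into V f \<longleftrightarrow>
     f ` V \<subseteq> V \<and> inj_on f V \<and> open (f ` V) \<and> C1_on V f \<and> C1_on (f ` V) (inv_into V f) \<and>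
     (\<forall>x\<in>V. \<exists>r>0. \<exists>T. orthogonal_transformation T \<and> (f has_derivative (\<lambda>h. r *\<^sub>R T h)) (at x))"

text \<open>
  \<open>\<phi> k i\<close> denotes the map \<open>\<phi>\<^sub>k\<^sub>,\<^sub>i\<close> together with its extension to \<open>V\<close>: on \<open>V\<close> it is that extension, and its
  values outside \<open>V\<close> are irrelevant. \<open>Jw u\<close> is the set \<open>J\<^sub>u\<close>.
\<close>

locale ncifs =
  fixes J :: "'a::euclidean_space set"
    and I :: "nat \<Rightarrow> 'i set"
    and \<phi> :: "nat \<Rightarrow> 'i \<Rightarrow> 'a \<Rightarrow> 'a"
    and Jw :: "'i list \<Rightarrow> 'a set"
    and V :: "'a set"
  assumes index_sets: "\<And>k. k \<ge> 1 \<Longrightarrow> finite (I k) \<and> card (I k) \<ge> 2"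
    and J: "compact J" "interior J \<noteq> {}" "closure (interior J) = J"
    and maps_J: "\<And>k i. k \<ge> 1 \<Longrightarrow> i \<in> I k \<Longrightarrow> \<phi> k i ` J \<subseteq> J"
    and Jw: "\<And>u. u \<in> finite_words I \<Longrightarrow> closed (Jw u) \<and> Jw u \<subseteq> J" "Jw [] = J"
    and contraction: "\<exists>c. 0 < c \<and> c < 1 \<and>
          (\<forall>k\<ge>1. \<forall>i\<in>I k. \<forall>x\<in>J. \<forall>y\<in>J. norm (\<phi> k i x - \<phi> k i y) \<le> c * norm (x - y))"
    and nested: "\<And>k u i. k \<ge> 1 \<Longrightarrow> u \<in> words I 1 (k - 1) \<Longrightarrow> i \<in> I k \<Longrightarrow> Jw (u @ [i]) \<subseteq> Jw u"
    and translate: "\<And>u. u \<in> finite_words I \<Longrightarrow> \<exists>\<omega>. Jw u = (\<lambda>x. comp_word \<phi> 1 u x + \<omega>) ` J"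
    and V: "open V" "connected V" "J \<subseteq> V"
    and conformal: "\<And>k i. k \<ge> 1 \<Longrightarrow> i \<in> I k \<Longrightarrow> conformal_diffeo_into V (\<phi> k i)"
    and distortion: "\<exists>C\<ge>1. \<forall>l k. 1 \<le> l \<longrightarrow> l \<le> k \<longrightarrow> (\<forall>u\<in>words I l k. \<forall>x\<in>V. \<forall>y\<in>V.
          deriv_norm (comp_word \<phi> l u) x \<le> C * deriv_norm (comp_word \<phi> l u) y)"

definition word_norm :: "'a::euclidean_space set \<Rightarrow> (nat \<Rightarrow> 'i \<Rightarrow> 'a \<Rightarrow> 'a) \<Rightarrow> 'i list \<Rightarrow> real" where
  "word_norm J \<phi> u = sup_deriv_norm J (comp_word \<phi> 1 u)"

definition max_norm ::
    "'a::euclidean_space set \<Rightarrow> (nat \<Rightarrow> 'i set) \<Rightarrow> (nat \<Rightarrow> 'i \<Rightarrow> 'a \<Rightarrow> 'a) \<Rightarrow> nat \<Rightarrow> real" where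
  "max_norm J I \<phi> k = Max (word_norm J \<phi> ` words I 1 k)"

definition min_norm ::
    "'a::euclidean_space set \<Rightarrow> (nat \<Rightarrow> 'i set) \<Rightarrow> (nat \<Rightarrow> 'i \<Rightarrow> 'a \<Rightarrow> 'a) \<Rightarrow> nat \<Rightarrow> real" where
  "min_norm J I \<phi> k = Min ((\<lambda>j. sup_deriv_norm J (\<phi> k j)) ` I k)"

definition coding :: "('i list \<Rightarrow> 'a set) \<Rightarrow> (nat \<Rightarrow> 'i) \<Rightarrow> 'a" where
  "coding Jw v = the_elem (\<Inter>n\<in>{1..}. Jw (word_prefix v n))"

definition image_measure ::
    "('i list \<Rightarrow> 'a::euclidean_space set) \<Rightarrow> (nat \<Rightarrow> 'i) measure \<Rightarrow> 'a measure" where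
  "image_measure Jw \<mu> = distr \<mu> borel (coding Jw)"


section \<open>Generalized dimensions\<close>

definition mesh_cubes :: "real \<Rightarrow> 'a::euclidean_space set set" where
  "mesh_cubes \<delta> = range (\<lambda>m :: 'a \<Rightarrow> int.
     {x. \<forall>b\<in>Basis. of_int (m b) * \<delta> \<le> x \<bullet> b \<and> x \<bullet> b < (of_int (m b) + 1) * \<delta>})"

definition ln_ereal :: "ereal \<Rightarrow> ereal" where
  "ln_ereal x = (if x = \<infinity> then \<infinity> else if x \<le> 0 then -\<infinity> else ereal (ln (real_of_ereal x)))"

text \<open>
  The sums run over infinitely many cubes and are taken in the extended reals, where they always
  exist for a finite measure (only finitely many cubes have mass greater than 1). The convention
  \<open>0 log 0 = 0\<close> is \<open>ln 0 = 0\<close>. For \<open>q = 1\<close> the quotient is not invariant under scaling of \<open>\<nu>\<close>: replacing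
  \<open>\<nu>\<close> by \<open>m\<nu>\<close> multiplies the limits by \<open>m\<close>.
\<close>

definition dim_quotient :: "real \<Rightarrow> 'a::euclidean_space measure \<Rightarrow> real \<Rightarrow> ereal" where
  "dim_quotient q \<nu> \<delta> =
     (if q = 1
      then (\<Sum>\<^sub>\<infinity>Q\<in>mesh_cubes \<delta>. ereal (measure \<nu> Q * ln (measure \<nu> Q))) / ereal (ln \<delta>)
      else ln_ereal (\<Sum>\<^sub>\<infinity>Q\<in>mesh_cubes \<delta>. ereal (measure \<nu> Q powr q)) / ereal ((q - 1) * ln \<delta>))"

definition lower_dim :: "real \<Rightarrow> 'a::euclidean_space measure \<Rightarrow> ereal" where
  "lower_dim q \<nu> = Liminf (at_right 0) (dim_quotient q \<nu>)"

definition upper_dim :: "real \<Rightarrow> 'a::euclidean_space measure \<Rightarrow> ereal" where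
  "upper_dim q \<nu> = Limsup (at_right 0) (dim_quotient q \<nu>)"


section \<open>Generalized pressures and their jump points\<close>

definition stopping_words ::
    "'a::euclidean_space set \<Rightarrow> (nat \<Rightarrow> 'i set) \<Rightarrow> (nat \<Rightarrow> 'i \<Rightarrow> 'a \<Rightarrow> 'a) \<Rightarrow> real \<Rightarrow> 'i list set" where
  "stopping_words J I \<phi> \<delta> =
     {u \<in> finite_words I. u \<noteq> [] \<and> word_norm J \<phi> u \<le> \<delta> \<and> \<delta> < word_norm J \<phi> (butlast u)}"

definition min_length ::
    "'a::euclidean_space set \<Rightarrow> (nat \<Rightarrow> 'i set) \<Rightarrow> (nat \<Rightarrow> 'i \<Rightarrow> 'a \<Rightarrow> 'a) \<Rightarrow> real \<Rightarrow> nat" where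
  "min_length J I \<phi> \<delta> = Inf (length ` stopping_words J I \<phi> \<delta>)"

definition pressure_quotient ::
    "'a::euclidean_space set \<Rightarrow> (nat \<Rightarrow> 'i set) \<Rightarrow> (nat \<Rightarrow> 'i \<Rightarrow> 'a \<Rightarrow> 'a) \<Rightarrow> (nat \<Rightarrow> 'i) measure
      \<Rightarrow> real \<Rightarrow> real \<Rightarrow> real \<Rightarrow> real" where
  "pressure_quotient J I \<phi> \<mu> t q \<delta> =
     (if q = 1
      then - (1 / real (min_length J I \<phi> \<delta>)) *
             (\<Sum>u\<in>stopping_words J I \<phi> \<delta>. measure \<mu> (cylinder I u) *
                ln (word_norm J \<phi> u powr (- t) * measure \<mu> (cylinder I u)))
      else sgn (1 - q) / real (min_length J I \<phi> \<delta>) *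
             ln (\<Sum>u\<in>stopping_words J I \<phi> \<delta>.
                word_norm J \<phi> u powr (t * (1 - q)) * measure \<mu> (cylinder I u) powr q))"

definition upper_pressure ::
    "'a::euclidean_space set \<Rightarrow> (nat \<Rightarrow> 'i set) \<Rightarrow> (nat \<Rightarrow> 'i \<Rightarrow> 'a \<Rightarrow> 'a) \<Rightarrow> (nat \<Rightarrow> 'i) measure
      \<Rightarrow> real \<Rightarrow> real \<Rightarrow> ereal" where
  "upper_pressure J I \<phi> \<mu> t q = Limsup (at_right 0) (\<lambda>\<delta>. ereal (pressure_quotient J I \<phi> \<mu> t q \<delta>))"

definition lower_pressure ::
    "'a::euclidean_space set \<Rightarrow> (nat \<Rightarrow> 'i set) \<Rightarrow> (nat \<Rightarrow> 'i \<Rightarrow> 'a \<Rightarrow> 'a) \<Rightarrow> (nat \<Rightarrow> 'i) measure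
      \<Rightarrow> real \<Rightarrow> real \<Rightarrow> ereal" where
  "lower_pressure J I \<phi> \<mu> t q = Liminf (at_right 0) (\<lambda>\<delta>. ereal (pressure_quotient J I \<phi> \<mu> t q \<delta>))"

definition upper_jump ::
    "'a::euclidean_space set \<Rightarrow> (nat \<Rightarrow> 'i set) \<Rightarrow> (nat \<Rightarrow> 'i \<Rightarrow> 'a \<Rightarrow> 'a) \<Rightarrow> (nat \<Rightarrow> 'i) measure
      \<Rightarrow> real \<Rightarrow> ereal" where
  "upper_jump J I \<phi> \<mu> q = Inf {ereal t |t. upper_pressure J I \<phi> \<mu> t q < 0}"

definition lower_jump ::
    "'a::euclidean_space set \<Rightarrow> (nat \<Rightarrow> 'i set) \<Rightarrow> (nat \<Rightarrow> 'i \<Rightarrow> 'a \<Rightarrow> 'a) \<Rightarrow> (nat \<Rightarrow> 'i) measure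
      \<Rightarrow> real \<Rightarrow> ereal" where
  "lower_jump J I \<phi> \<mu> q = Inf {ereal t |t. lower_pressure J I \<phi> \<mu> t q < 0}"

end

theory Submission
  imports Defs
begin

text \<open>
  At scale \<open>\<delta>\<close> compare two partitions of \<open>\<Sigma>\<^sup>\<infinity>\<close>: the preimages of the mesh cubes, and the cylinders of the
  stopping words. The pieces \<open>J\<^sub>u\<close> of stopping words have diameter at most \<open>L\<delta>\<close>, so each meets a
  bounded number \<open>K\<close> of cubes, and convexity of \<open>\<plusminus>x powr q\<close> (of \<open>x ln x\<close> if \<open>q = 1\<close>) shows that passing from
  cylinders to cubes costs at most \<open>ln K\<close> in the logarithmic moment. The hypothesis on the norms forces
  \<open>ln \<parallel>D\<phi>\<^sub>u\<parallel> / ln \<delta> \<rightarrow> 1\<close> uniformly over the stopping words, so a negative pressure at \<open>t\<close> bounds the moment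
  over the cylinders by \<open>t ln \<delta>\<close> up to a factor tending to \<open>1\<close>. Comparing with the trivial partition
  instead gives the bound by \<open>d\<close>.
\<close>

text \<open>Because \<open>ln \<delta>\<close> is negative, an upper bound for a dimension is a
  lower bound for a logarithmic moment, and dividing by q - 1 makes this direction the same for
  every q. So only one comparison is needed: splitting a cylinder among few cubes loses little, and
  merging many cylinders into one cube loses nothing. Pieces may therefore overlap arbitrarily. The
  obstacle is that a single strongly contracting step can push the norm of a stopping word far below
  \<delta>, which would spoil the exponent t; the norm hypothesis makes one such step negligible on
  the logarithmic scale. At q = 1 the total mass must be at most 1: a mass m spread evenly over a
  cube has quotients tending to m d, which exceeds d once m > 1. For other q the mass only
  contributes a constant, which vanishes against \<open>ln \<delta>\<close>.\<close>

section \<open>Power sums under refinement\<close>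

text \<open>
  The summand is written as \<open>x * ent_slope q x\<close> (that is \<open>x ln x\<close> or \<open>\<plusminus>x powr q\<close>): convexity in \<open>x\<close> bounds the
  cost of splitting a cylinder, monotonicity of the slope gives superadditivity within a cube.
\<close>

definition ent_slope :: "real \<Rightarrow> real \<Rightarrow> real" where
  "ent_slope q x = (if q = 1 then ln x else sgn (q - 1) * x powr (q - 1))"

text \<open>For q < 1 the power decreases and the sign reverses it. Positivity matters:
  \<open>ln 0\<close> and \<open>0 powr (q - 1)\<close> are 0, above the nearby values when q is at
  most 1.\<close>

lemma ent_slope_mono:
  assumes "0 < x" "x \<le> y"
  shows "ent_slope q x \<le> ent_slope q y"
proof -
  consider "q = 1" | "q > 1" | "q < 1" by linarith
  then show ?thesis
    by cases (use assms powr_mono2[of "q - 1" x y] powr_mono2'[of "q - 1" x y]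
        in \<open>auto simp: ent_slope_def sgn_if\<close>)
qed

text \<open>The second derivative of \<open>x * ent_slope q x\<close> is 1 / x or |q - 1| q x^(q-2),
  nonnegative as q > 0. The supporting-line form feeds directly into Jensen's inequality.\<close>

lemma ent_slope_tangent:
  assumes "q > 0"
  obtains D where "\<And>y x. 0 < y \<Longrightarrow> 0 \<le> x \<Longrightarrow> y * ent_slope q y + D y * (x - y) \<le> x * ent_slope q x"
proof -
  define D where "D y = (if q = 1 then ln y + 1 else sgn (q - 1) * (q * y powr (q - 1)))" for y
  define D2 where "D2 y = (if q = 1 then 1 / y else sgn (q - 1) * (q * ((q - 1) * y powr (q - 1 - 1))))" for y
  have eq: "x * ent_slope q x = (if q = 1 then x * ln x else sgn (q - 1) * x powr q)" if "x > 0" for x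
    using that powr_add[of x 1 "q - 1"] by (simp add: ent_slope_def)
  have D: "((\<lambda>x. x * ent_slope q x) has_real_derivative D x) (at x)" if "x > 0" for x
  proof -
    have "((\<lambda>x. if q = 1 then x * ln x else sgn (q - 1) * x powr q) has_real_derivative D x) (at x)"
      using that by (auto simp: D_def intro!: derivative_eq_intros)
    then show ?thesis
      by (rule has_field_derivative_transform_within_open[where S = "{0<..}"]) (use that eq in auto)
  qed
  have D2: "(D has_real_derivative D2 x) (at x)" if "x > 0" for x
    unfolding D_def D2_def using that by (auto intro!: derivative_eq_intros)
  have pos: "D2 x \<ge> 0" if "x > 0" for x
    using that assms by (auto simp: D2_def sgn_if mult_le_0_iff)
  have main: "y * ent_slope q y + D y * (x - y) \<le> x * ent_slope q x" if "0 < y" "0 < x" for x y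
    using f''_imp_f'[of "{0<..}" "\<lambda>x. x * ent_slope q x" D D2 y x] D D2 pos that by auto
  have "y * ent_slope q y + D y * (x - y) \<le> x * ent_slope q x" if y: "0 < y" and x: "0 \<le> x" for x y
  proof (cases "x = 0")
    case True
    consider "q = 1" | "q > 1" | "q < 1" by linarith
    \<comment> \<open>The endpoint 0 lies outside the open half-line of the second-derivative
      argument; there the claim reduces to slope at most derivative.\<close>
    then have "ent_slope q y \<le> D y"
    proof cases
      case 2
      then show ?thesis
        using mult_right_mono[of 1 q "y powr (q - 1)"] y by (simp add: ent_slope_def D_def)
    next
      case 3
      then show ?thesis
        using mult_right_mono[of q 1 "y powr (q - 1)"] y by (simp add: ent_slope_def D_def)
    qed (simp add: ent_slope_def D_def)
    then show ?thesis
      using True y mult_left_mono[of "ent_slope q y" "D y" y] by (simp add: algebra_simps)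
  qed (use main y x in simp)
  then show thesis by (rule that)
qed

text \<open>Jensen over the n nonzero terms gives the bound with n in place of \<open>K\<close>;
  since n is at most \<open>K\<close> and the slope is monotone, \<open>K\<close> may replace it.
  Zero terms are dropped first, as they would enter n.\<close>

lemma sum_ent_slope_ge:
  fixes a :: "'b \<Rightarrow> real"
  assumes "q > 0" "finite F" "\<And>Q. Q \<in> F \<Longrightarrow> a Q \<ge> 0" "card {Q\<in>F. a Q \<noteq> 0} \<le> K"
  shows "(\<Sum>Q\<in>F. a Q) * ent_slope q ((\<Sum>Q\<in>F. a Q) / K) \<le> (\<Sum>Q\<in>F. a Q * ent_slope q (a Q))"
proof -
  define G where "G = {Q\<in>F. a Q \<noteq> 0}"
  define r n where "r = (\<Sum>Q\<in>F. a Q)" and "n = real (card G)"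
  have G: "finite G" "G \<subseteq> F" and r: "r = (\<Sum>Q\<in>G. a Q)"
    using \<open>finite F\<close> by (auto simp: G_def r_def intro!: sum.mono_neutral_right)
  have rhs: "(\<Sum>Q\<in>F. a Q * ent_slope q (a Q)) = (\<Sum>Q\<in>G. a Q * ent_slope q (a Q))"
    using \<open>finite F\<close> by (auto simp: G_def intro!: sum.mono_neutral_right)
  have "r * ent_slope q (r / K) \<le> (\<Sum>Q\<in>G. a Q * ent_slope q (a Q))"
  proof (cases "r = 0")
    case True
    then have "G = {}"
      using assms(2,3) unfolding r_def G_def by (subst (asm) sum_nonneg_eq_0_iff) auto
    then show ?thesis using True by simp
  next
    case False
    then have "r > 0" using assms(3) sum_nonneg[of F a] by (simp add: r_def)
    moreover have "n > 0" using False G r by (auto simp: n_def card_gt_0_iff)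
    moreover have "n \<le> K" using assms(4) by (simp add: n_def G_def)
    ultimately have "r / K > 0" "r / K \<le> r / n" and y: "r / n > 0"
      by (auto simp: frac_le)
    then have "r * ent_slope q (r / K) \<le> r * ent_slope q (r / n)"
      using \<open>r > 0\<close> by (intro mult_left_mono ent_slope_mono) auto
    also obtain D where D: "\<And>y x. 0 < y \<Longrightarrow> 0 \<le> x \<Longrightarrow> y * ent_slope q y + D y * (x - y) \<le> x * ent_slope q x"
      using ent_slope_tangent[OF \<open>q > 0\<close>] by blast
    \<comment> \<open>With the tangent taken at the mean, the linear terms sum to zero.\<close>
    have "r * ent_slope q (r / n) = (\<Sum>Q\<in>G. r / n * ent_slope q (r / n) + D (r / n) * (a Q - r / n))"
      using \<open>n > 0\<close> by (simp add: sum.distrib sum_subtractf sum_distrib_left[symmetric] r[symmetric] n_def[symmetric])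
    also have "\<dots> \<le> (\<Sum>Q\<in>G. a Q * ent_slope q (a Q))"
      using D[OF y] G assms(3) by (intro sum_mono) auto
    finally show ?thesis .
  qed
  then show ?thesis by (simp add: r_def rhs)
qed

lemma sum_ent_slope_superadditive:
  fixes a :: "'b \<Rightarrow> real"
  assumes "finite U" "\<And>u. u \<in> U \<Longrightarrow> a u \<ge> 0"
  shows "(\<Sum>u\<in>U. a u * ent_slope q (a u)) \<le> (\<Sum>u\<in>U. a u) * ent_slope q (\<Sum>u\<in>U. a u)"
  unfolding sum_distrib_right
proof (rule sum_mono)
  fix u assume u: "u \<in> U"
  then have "a u \<le> (\<Sum>u\<in>U. a u)" using assms by (intro member_le_sum) auto
  then show "a u * ent_slope q (a u) \<le> a u * ent_slope q (\<Sum>u\<in>U. a u)"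
    using assms(2)[OF u] by (cases "a u = 0") (auto intro!: ent_slope_mono)
qed

text \<open>For probability vectors this is the negative of the Renyi entropy of order q (Shannon
  entropy at q = 1). The normalisation turns the dimension quotient into this moment divided by
  \<open>ln \<delta>\<close>.\<close>

definition log_moment :: "real \<Rightarrow> 'b set \<Rightarrow> ('b \<Rightarrow> real) \<Rightarrow> real" where
  "log_moment q A x =
     (if q = 1 then \<Sum>i\<in>A. x i * ln (x i) else ln (\<Sum>i\<in>A. x i powr q) / (q - 1))"

lemma powr_sum_pos:
  fixes x :: "'b \<Rightarrow> real"
  assumes "finite A" "(\<Sum>i\<in>A. x i) > 0"
  shows "(\<Sum>i\<in>A. x i powr q) > 0"
proof -
  obtain i where "i \<in> A" "x i \<noteq> 0"
    using assms(2) by (metis less_irrefl sum.neutral)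
  then show ?thesis using assms(1) by (intro sum_pos2[of A i]) auto
qed

text \<open>\<open>a u Q\<close> is the joint mass of a cell u of one partition and a cell Q of the
  other. Jensen acts on each row, superadditivity on each column, and exchanging the sums joins
  them. The cost is \<open>m * ln K\<close> at q = 1, hence the bound on \<open>m\<close>, and
  \<open>ln K\<close> otherwise.\<close>

lemma log_moment_compare:
  fixes a :: "'u \<Rightarrow> 'b \<Rightarrow> real"
  assumes "q > 0" "finite U" "finite F" "K > 0"
    and a: "\<And>u Q. u \<in> U \<Longrightarrow> Q \<in> F \<Longrightarrow> a u Q \<ge> 0"
    and card: "\<And>u. u \<in> U \<Longrightarrow> card {Q\<in>F. a u Q \<noteq> 0} \<le> K"
    and r: "\<And>u. u \<in> U \<Longrightarrow> r u = (\<Sum>Q\<in>F. a u Q)"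
    and s: "\<And>Q. Q \<in> F \<Longrightarrow> s Q = (\<Sum>u\<in>U. a u Q)"
    and m: "m = (\<Sum>u\<in>U. r u)" "m > 0" "q = 1 \<Longrightarrow> m \<le> 1"
  shows "log_moment q U r - ln K \<le> log_moment q F s"
proof -
  have r0: "r u \<ge> 0" if "u \<in> U" for u using that a r by (simp add: sum_nonneg)
  have s0: "s Q \<ge> 0" if "Q \<in> F" for Q using that a s by (simp add: sum_nonneg)
  have ms: "(\<Sum>Q\<in>F. s Q) = m"
    using sum.swap[of a F U] r s m(1) by simp
  have main: "(\<Sum>u\<in>U. r u * ent_slope q (r u / K)) \<le> (\<Sum>Q\<in>F. s Q * ent_slope q (s Q))"
  proof -
    have "(\<Sum>u\<in>U. r u * ent_slope q (r u / K)) \<le> (\<Sum>u\<in>U. \<Sum>Q\<in>F. a u Q * ent_slope q (a u Q))"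
      using sum_ent_slope_ge[OF \<open>q > 0\<close> \<open>finite F\<close> a card] r by (intro sum_mono) auto
    also have "\<dots> = (\<Sum>Q\<in>F. \<Sum>u\<in>U. a u Q * ent_slope q (a u Q))" by (rule sum.swap)
    also have "\<dots> \<le> (\<Sum>Q\<in>F. s Q * ent_slope q (s Q))"
      using sum_ent_slope_superadditive[OF \<open>finite U\<close>] a s by (intro sum_mono) auto
    finally show ?thesis .
  qed
  show ?thesis
  proof (cases "q = 1")
    case True
    have "real K \<ge> 1" using \<open>K > 0\<close> by simp
    have "(\<Sum>u\<in>U. r u * ent_slope q (r u / K)) = (\<Sum>u\<in>U. r u * ln (r u) - r u * ln K)"
      using \<open>K > 0\<close> True r0
      by (intro sum.cong refl) (auto simp: ent_slope_def ln_div algebra_simps)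
    also have "\<dots> = (\<Sum>u\<in>U. r u * ln (r u)) - m * ln K"
      by (simp add: sum_subtractf m(1) sum_distrib_right)
    also have "\<dots> \<ge> (\<Sum>u\<in>U. r u * ln (r u)) - ln K"
      using m(3)[OF True] \<open>real K \<ge> 1\<close> by (simp add: mult_left_le_one_le m(2) less_imp_le)
    finally show ?thesis using main True by (simp add: log_moment_def ent_slope_def)
  next
    case False
    define A B where "A = (\<Sum>u\<in>U. r u powr q)" and "B = (\<Sum>Q\<in>F. s Q powr q)"
    have A: "A > 0" and B: "B > 0"
      unfolding A_def B_def using m ms assms(2,3) by (auto intro!: powr_sum_pos)
    \<comment> \<open>By homogeneity the factor leaves the sum as \<open>K powr (1 - q)\<close>;
      after \<open>ln\<close> and division by q - 1 it is the term \<open>- ln K\<close>.\<close>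
    have e: "x * ent_slope q (x / k) = sgn (q - 1) * k powr (1 - q) * x powr q" if "x \<ge> 0" "k > 0" for x k :: real
    proof (cases "x = 0")
      case False
      have "x powr (q - 1) = x powr q / x" using False that by (simp add: powr_diff)
      moreover have "k powr (1 - q) = 1 / k powr (q - 1)" by (metis minus_diff_eq powr_minus_divide)
      ultimately show ?thesis using that False \<open>q \<noteq> 1\<close> by (simp add: ent_slope_def powr_divide)
    qed (use that in simp)
    have "sgn (q - 1) * (K powr (1 - q) * A) \<le> sgn (q - 1) * B"
      using main e[of _ K] e[of _ 1] r0 s0 \<open>K > 0\<close>
      by (simp add: A_def B_def sum_distrib_left mult.assoc cong: sum.cong)
    then have "sgn (q - 1) * ln (K powr (1 - q) * A) \<le> sgn (q - 1) * ln B"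
      using A B \<open>K > 0\<close> False by (auto simp: sgn_if split: if_splits)
    moreover have "ln (K powr (1 - q) * A) = (1 - q) * ln K + ln A"
      using A \<open>K > 0\<close> by (simp add: ln_mult)
    moreover have "(1 - q) * ln K + ln A = ln A - (q - 1) * ln K"
      by (simp add: algebra_simps)
    ultimately have "sgn (q - 1) * (ln A - (q - 1) * ln K) \<le> sgn (q - 1) * ln B"
      by simp
    then have "(ln A - (q - 1) * ln K) / (q - 1) \<le> ln B / (q - 1)"
      using False by (auto simp: sgn_if divide_right_mono divide_right_mono_neg split: if_splits)
    then show ?thesis
      using False by (simp add: log_moment_def A_def B_def diff_divide_distrib)
  qed
qed

section \<open>Mesh cubes\<close>

lemma mesh_cubes_borel: "Q \<in> mesh_cubes \<delta> \<Longrightarrow> Q \<in> sets (borel :: 'a::euclidean_space measure)"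
proof -
  have "{x::'a. \<forall>b\<in>Basis. l b \<le> x \<bullet> b \<and> x \<bullet> b < h b} \<in> sets borel" for l h :: "'a \<Rightarrow> real"
    by measurable
  then show "Q \<in> mesh_cubes \<delta> \<Longrightarrow> Q \<in> sets (borel :: 'a measure)"
    unfolding mesh_cubes_def by fast
qed

lemma mesh_index:
  assumes "\<delta> > 0"
  shows "of_int n * \<delta> \<le> y \<and> y < (of_int n + 1) * \<delta> \<longleftrightarrow> n = \<lfloor>y / \<delta>\<rfloor>"
  using assms floor_eq_iff[of "y / \<delta>" n] by (auto simp: pos_le_divide_eq pos_divide_less_eq)

text \<open>As level sets of the coordinatewise floor, half-open cubes are trivially disjoint and
  covering.\<close>

lemma mesh_cubes_eq:
  assumes "\<delta> > 0"
  shows "mesh_cubes \<delta> = range (\<lambda>m. {x::'a::euclidean_space. \<forall>b\<in>Basis. m b = \<lfloor>x \<bullet> b / \<delta>\<rfloor>})"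
  unfolding mesh_cubes_def mesh_index[OF assms] ..

lemma mesh_cubes_cover:
  assumes "\<delta> > 0"
  shows "\<exists>Q\<in>mesh_cubes \<delta>. (x::'a::euclidean_space) \<in> Q"
  unfolding mesh_cubes_eq[OF assms] by (auto intro!: exI[of _ "\<lambda>b. \<lfloor>x \<bullet> b / \<delta>\<rfloor>"])

lemma mesh_cubes_disjoint:
  assumes "\<delta> > 0" "Q \<in> mesh_cubes \<delta>" "Q' \<in> mesh_cubes \<delta>" "x \<in> Q" "x \<in> Q'"
  shows "Q = Q'"
  using assms unfolding mesh_cubes_eq[OF assms(1)] by auto

text \<open>Each coordinate on \<open>A\<close> stays in an interval of length 2R centred at that of
  one chosen point, and such an interval meets at most floor(2R/\<delta>) + 2 half-open intervals of
  length \<delta>.\<close>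

lemma mesh_cubes_meeting_bounded:
  fixes A :: "'a::euclidean_space set"
  assumes "\<delta> > 0" "R \<ge> 0" and A: "\<And>x y. x \<in> A \<Longrightarrow> y \<in> A \<Longrightarrow> norm (x - y) \<le> R"
  shows "finite {Q\<in>mesh_cubes \<delta>. Q \<inter> A \<noteq> {}}"
    and "real (card {Q\<in>mesh_cubes \<delta>. Q \<inter> A \<noteq> {}}) \<le> (2 * R / \<delta> + 2) ^ DIM('a)"
proof -
  let ?F = "{Q\<in>mesh_cubes \<delta>. Q \<inter> A \<noteq> {}}"
  have "finite ?F \<and> real (card ?F) \<le> (2 * R / \<delta> + 2) ^ DIM('a)"
  proof (cases "A = {}")
    case False
    then obtain a where "a \<in> A" by auto
    define N where "N = \<lfloor>2 * R / \<delta>\<rfloor> + 2"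
    define G where "G = (\<lambda>k b. \<lfloor>(a \<bullet> b - R) / \<delta>\<rfloor> + k b) ` (PiE Basis (\<lambda>b::'a. {0..<N}))"
    have N: "0 \<le> N" using assms(1,2) by (simp add: N_def)
    have "?F \<subseteq> (\<lambda>m. {x. \<forall>b\<in>Basis. m b = \<lfloor>x \<bullet> b / \<delta>\<rfloor>}) ` G"
    proof
      fix Q assume "Q \<in> ?F"
      then obtain x where x: "x \<in> A" "x \<in> Q" by auto
      obtain m where Q: "Q = {x. \<forall>b\<in>Basis. m b = \<lfloor>x \<bullet> b / \<delta>\<rfloor>}"
        using \<open>Q \<in> ?F\<close> unfolding mesh_cubes_eq[OF assms(1)] by blast
      \<comment> \<open>The offset of the cube from the lowest possible index;
        \<open>restrict\<close> puts it into the finite function space.\<close>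
      define k where "k = restrict (\<lambda>b. m b - \<lfloor>(a \<bullet> b - R) / \<delta>\<rfloor>) Basis"
      have "k \<in> PiE Basis (\<lambda>b. {0..<N})"
      proof (rule PiE_I)
        fix b :: 'a assume b: "b \<in> Basis"
        have "\<bar>(x - a) \<bullet> b\<bar> \<le> R"
          using Basis_le_norm[OF b, of "x - a"] A[OF x(1) \<open>a \<in> A\<close>] by linarith
        then have "a \<bullet> b - R \<le> x \<bullet> b" "x \<bullet> b \<le> (a \<bullet> b - R) + 2 * R"
          by (auto simp: inner_diff_left abs_le_iff)
        then have "(a \<bullet> b - R) / \<delta> \<le> x \<bullet> b / \<delta>" "x \<bullet> b / \<delta> \<le> (a \<bullet> b - R) / \<delta> + 2 * R / \<delta>"
          using assms(1) by (auto simp: divide_right_mono add_divide_distrib[symmetric])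
        then have "\<lfloor>(a \<bullet> b - R) / \<delta>\<rfloor> \<le> \<lfloor>x \<bullet> b / \<delta>\<rfloor>"
            "\<lfloor>x \<bullet> b / \<delta>\<rfloor> \<le> \<lfloor>(a \<bullet> b - R) / \<delta>\<rfloor> + \<lfloor>2 * R / \<delta>\<rfloor> + 1"
          by linarith+
        moreover have "m b = \<lfloor>x \<bullet> b / \<delta>\<rfloor>" using x(2) b by (auto simp: Q)
        ultimately show "k b \<in> {0..<N}" using b by (auto simp: k_def N_def)
      qed (simp add: k_def)
      moreover define g where "g = (\<lambda>b. \<lfloor>(a \<bullet> b - R) / \<delta>\<rfloor> + k b)"
      ultimately have "g \<in> G" unfolding G_def by blast
      moreover have "Q = {x. \<forall>b\<in>Basis. g b = \<lfloor>x \<bullet> b / \<delta>\<rfloor>}"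
        by (simp add: Q k_def g_def)
      ultimately show "Q \<in> (\<lambda>m. {x. \<forall>b\<in>Basis. m b = \<lfloor>x \<bullet> b / \<delta>\<rfloor>}) ` G"
        by blast
    qed
    moreover have "finite G" unfolding G_def by (intro finite_imageI finite_PiE) auto
    moreover have "card G \<le> card (PiE (Basis :: 'a set) (\<lambda>b. {0..<N}))"
      unfolding G_def by (intro card_image_le finite_PiE) auto
    moreover have "card (PiE (Basis :: 'a set) (\<lambda>b. {0..<N})) = nat N ^ DIM('a)"
      by (simp add: card_PiE)
    ultimately have "finite ?F" and "card ?F \<le> card G" and "card G \<le> nat N ^ DIM('a)"
      by (auto intro: finite_surj surj_card_le)
    then have "finite ?F" "card ?F \<le> nat N ^ DIM('a)" by auto
    moreover have "real (nat N) \<le> 2 * R / \<delta> + 2"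
      using N unfolding N_def by simp
    ultimately show ?thesis
      by (smt (verit) of_nat_0_le_iff of_nat_le_iff of_nat_power power_mono)
  qed (use assms in simp)
  then show "finite ?F" "real (card ?F) \<le> (2 * R / \<delta> + 2) ^ DIM('a)" by auto
qed

text \<open>Finite support collapses the extended sum to a real one, and positive total mass makes
  the power sum positive, which selects the real branch of \<open>ln_ereal\<close>.\<close>

lemma dim_quotient_eq_log_moment:
  fixes \<nu> :: "'a::euclidean_space measure"
  assumes "finite F" "F \<subseteq> mesh_cubes \<delta>" "\<And>Q. Q \<in> mesh_cubes \<delta> - F \<Longrightarrow> measure \<nu> Q = 0"
    and "(\<Sum>Q\<in>F. measure \<nu> Q) > 0" "ln \<delta> \<noteq> 0"
  shows "dim_quotient q \<nu> \<delta> = ereal (log_moment q F (measure \<nu>) / ln \<delta>)"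
proof -
  \<comment> \<open>Applied to two functions that vanish at 0 by convention:
    \<open>0 * ln 0 = 0\<close> and \<open>0 powr q = 0\<close>.\<close>
  have *: "(\<Sum>\<^sub>\<infinity>Q\<in>mesh_cubes \<delta>. ereal (f (measure \<nu> Q))) = ereal (\<Sum>Q\<in>F. f (measure \<nu> Q))"
    if "f 0 = 0" for f
  proof -
    have "(\<Sum>\<^sub>\<infinity>Q\<in>mesh_cubes \<delta>. ereal (f (measure \<nu> Q))) = (\<Sum>\<^sub>\<infinity>Q\<in>F. ereal (f (measure \<nu> Q)))"
      using assms that by (intro infsum_cong_neutral) auto
    then show ?thesis using assms(1) by simp
  qed
  show ?thesis
  proof (cases "q = 1")
    case True
    then show ?thesis using *[of "\<lambda>x. x * ln x"] assms(5) by (simp add: dim_quotient_def log_moment_def)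
  next
    case False
    have "(\<Sum>Q\<in>F. measure \<nu> Q powr q) > 0" by (rule powr_sum_pos[OF assms(1,4)])
    then show ?thesis using False *[of "\<lambda>x. x powr q"] assms(5)
      by (simp add: dim_quotient_def log_moment_def ln_ereal_def)
  qed
qed

section \<open>Words and cylinders\<close>

lemma length_word_prefix [simp]: "length (word_prefix v n) = n"
  by (simp add: word_prefix_def)

lemma word_prefix_0 [simp]: "word_prefix v 0 = []"
  by (simp add: word_prefix_def)

lemma word_prefix_Suc: "word_prefix v (Suc n) = word_prefix v n @ [v (Suc n)]"
  by (simp add: word_prefix_def)

lemma word_prefix_eq_iff: "word_prefix u n = word_prefix v n \<longleftrightarrow> (\<forall>j. 1 \<le> j \<and> j \<le> n \<longrightarrow> u j = v j)"
  unfolding word_prefix_def map_eq_conv by (auto simp del: upt_Suc)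

lemma word_prefix_in_words: "v \<in> inf_words I \<Longrightarrow> word_prefix v n \<in> words I 1 n"
  by (auto simp: words_def inf_words_def word_prefix_def PiE_iff simp del: upt_Suc)

lemma words_snoc_iff: "u @ [i] \<in> words I 1 (Suc n) \<longleftrightarrow> u \<in> words I 1 n \<and> i \<in> I (Suc n)"
  by (auto simp: words_def nth_append all_conj_distrib less_Suc_eq)

lemma words_0 [simp]: "words I (Suc 0) 0 = {[]}"
  by (auto simp: words_def)

lemma finite_words_iff: "u \<in> finite_words I \<longleftrightarrow> u \<in> words I 1 (length u)"
  by (auto simp: finite_words_def words_def)

lemma finite_words_set:
  assumes "\<And>j. l \<le> j \<Longrightarrow> j \<le> k \<Longrightarrow> finite (I j)"
  shows "finite (words I l k)"
proof (rule finite_subset)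
  show "words I l k \<subseteq> {u. set u \<subseteq> (\<Union>j\<in>{l..k}. I j) \<and> length u = Suc k - l}"
    by (fastforce simp: words_def in_set_conv_nth)
  show "finite {u. set u \<subseteq> (\<Union>j\<in>{l..k}. I j) \<and> length u = Suc k - l}"
    using assms by (intro finite_lists_length_eq) auto
qed

text \<open>Distances of distinct words are 2^-g with g the length of the common prefix, so the
  strict inequality at level n forces one letter more, agreement up to n + 1.\<close>

lemma word_dist_less_iff:
  assumes "u \<in> inf_words I" "v \<in> inf_words I"
  shows "word_dist u v < (1/2) ^ n \<longleftrightarrow> word_prefix u (Suc n) = word_prefix v (Suc n)"
proof (cases "u = v")
  case False
  then obtain i where i: "u i \<noteq> v i" by auto
  \<comment> \<open>Both words are \<open>undefined\<close> at 0 by extensionality, so they differ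
    at a genuine index; it bounds the common prefixes, as \<open>GREATEST\<close> requires.\<close>
  then have "i \<ge> 1" using assms by (cases "i \<ge> 1") (auto simp: inf_words_def PiE_iff extensional_def)
  then have bd: "\<And>k. word_prefix u k = word_prefix v k \<Longrightarrow> k \<le> i"
    using i by (auto simp: word_prefix_eq_iff)
  define g where "g = (GREATEST n. word_prefix u n = word_prefix v n)"
  have g: "word_prefix u g = word_prefix v g"
    unfolding g_def by (rule GreatestI_nat[of _ 0 i]) (use bd in auto)
  have "word_prefix u (Suc n) = word_prefix v (Suc n) \<longleftrightarrow> Suc n \<le> g"
    using Greatest_le_nat[of "\<lambda>n. word_prefix u n = word_prefix v n" "Suc n" i] bd g
    unfolding g_def[symmetric] by (auto simp: word_prefix_eq_iff)
  then show ?thesis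
    using False by (simp add: word_dist_def g_def[symmetric] Suc_le_eq power_strict_decreasing_iff del: power_one_over)
qed (simp add: word_dist_def)

lemma word_dist_cases:
  obtains "u = v" "word_dist u v = 0" | n where "u \<noteq> v" "word_dist u v = (1/2) ^ n"
  by (cases "u = v") (auto simp: word_dist_def)

text \<open>The triangle inequality is really ultrametric: if two sides are below 2^-n, both pairs
  agree on n + 1 letters, hence so does the third pair.\<close>

lemma Metric_space_inf_words: "Metric_space (inf_words I) word_dist"
proof
  show "0 \<le> word_dist x y" for x y :: "nat \<Rightarrow> 'a" by (cases x y rule: word_dist_cases) auto
  show "word_dist x y = word_dist y x" for x y :: "nat \<Rightarrow> 'a"
    by (simp add: word_dist_def eq_commute)
  show "word_dist x y = 0 \<longleftrightarrow> x = y" for x y :: "nat \<Rightarrow> 'a"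
    by (cases x y rule: word_dist_cases) auto
  fix x y z assume X: "x \<in> inf_words I" "y \<in> inf_words I" "z \<in> inf_words I"
  show "word_dist x z \<le> word_dist x y + word_dist y z"
  proof (cases x z rule: word_dist_cases)
    case (2 n)
    show ?thesis
    proof (rule ccontr)
      assume *: "\<not> ?thesis"
      have "word_dist x y \<ge> 0" "word_dist y z \<ge> 0"
        by (cases x y rule: word_dist_cases; simp) (cases y z rule: word_dist_cases; simp)
      with * 2 have "word_dist x y < (1/2) ^ n" "word_dist y z < (1/2) ^ n" by auto
      then have "word_dist x z < (1/2) ^ n" using X by (simp add: word_dist_less_iff del: power_one_over)
      with 2 show False by simp
    qed
  qed (cases x y rule: word_dist_cases; cases y z rule: word_dist_cases; simp)
qed

lemma space_borel_words [simp]: "space (borel_words I) = inf_words I"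
proof -
  interpret Metric_space "inf_words I" word_dist by (rule Metric_space_inf_words)
  show ?thesis
    unfolding borel_words_def by (rule space_measure_of) (auto simp: openin_mtopology)
qed

lemma cylinder_in_borel_words [measurable]: "cylinder I u \<in> sets (borel_words I)"
proof -
  interpret Metric_space "inf_words I" word_dist by (rule Metric_space_inf_words)
  have "mball v ((1/2) ^ length u) \<subseteq> cylinder I u" if v: "v \<in> cylinder I u" for v
  proof
    fix w assume "w \<in> mball v ((1/2) ^ length u)"
    then have w: "v \<in> inf_words I" "w \<in> inf_words I" "word_dist v w < (1/2) ^ length u"
      by (auto simp: in_mball)
    then have "word_prefix w (length u) = word_prefix v (length u)"
      by (simp add: word_dist_less_iff word_prefix_Suc del: power_one_over)
    then show "w \<in> cylinder I u" using v w by (simp add: cylinder_def)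
  qed
  then have "openin mtopology (cylinder I u)"
    unfolding openin_mtopology
    by (auto simp: cylinder_def intro!: exI[of _ "(1/2) ^ length u"] simp del: power_one_over)
  then show ?thesis
    unfolding borel_words_def by (subst sets_measure_of) (auto simp: openin_mtopology)
qed

section \<open>Derivatives of word maps\<close>

text \<open>Keeps the factor r explicit: for similarities the norms of derivatives multiply exactly
  under composition, where general operator norms give only an inequality. Lower bounds for word
  norms rest on this.\<close>

definition similar_deriv :: "('a::euclidean_space \<Rightarrow> 'a) \<Rightarrow> 'a \<Rightarrow> real \<Rightarrow> bool" where
  "similar_deriv f x r \<longleftrightarrow>
     r > 0 \<and> (\<exists>T. orthogonal_transformation T \<and> (f has_derivative (\<lambda>h. r *\<^sub>R T h)) (at x))"

lemma similar_deriv_norm: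
  fixes f :: "'a::euclidean_space \<Rightarrow> 'a"
  assumes "similar_deriv f x r"
  shows "deriv_norm f x = r"
proof -
  obtain T where T: "r > 0" "orthogonal_transformation T" and D: "(f has_derivative (\<lambda>h. r *\<^sub>R T h)) (at x)"
    using assms by (auto simp: similar_deriv_def)
  have n: "norm (r *\<^sub>R T h) = r * norm h" for h
    using T by (simp add: orthogonal_transformation_norm)
  obtain b :: 'a where b: "b \<in> Basis" by (meson nonempty_Basis ex_in_conv)
  have "r \<le> onorm (\<lambda>h. r *\<^sub>R T h)"
    using onorm[OF has_derivative_bounded_linear[OF D], of b] b n[of b] by simp
  moreover have "onorm (\<lambda>h. r *\<^sub>R T h) \<le> r" by (rule onorm_le) (simp only: n order_refl)
  ultimately show ?thesis by (simp add: deriv_norm_def frechet_derivative_at[OF D, symmetric])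
qed

lemma similar_deriv_id: "similar_deriv id x 1"
  unfolding similar_deriv_def
  by (intro conjI exI[of _ "\<lambda>h. h"]) (simp_all add: id_def orthogonal_transformation_def linear_iff)

lemma similar_deriv_comp:
  assumes "similar_deriv g x r" "similar_deriv f (g x) s"
  shows "similar_deriv (f \<circ> g) x (s * r)"
proof -
  obtain T where T: "r > 0" "orthogonal_transformation T" "(g has_derivative (\<lambda>h. r *\<^sub>R T h)) (at x)"
    using assms(1) by (auto simp: similar_deriv_def)
  obtain T' where T': "s > 0" "orthogonal_transformation T'" "(f has_derivative (\<lambda>h. s *\<^sub>R T' h)) (at (g x))"
    using assms(2) by (auto simp: similar_deriv_def)
  have "(f \<circ> g has_derivative (\<lambda>h. (s * r) *\<^sub>R (T' \<circ> T) h)) (at x)"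
    using diff_chain_at[OF T(3) T'(3)] orthogonal_transformation_linear[OF T'(2)]
    by (simp add: o_def linear_scale)
  moreover have "orthogonal_transformation (T' \<circ> T)"
    using T T' by (intro orthogonal_transformation_compose)
  ultimately show ?thesis
    unfolding similar_deriv_def using T(1) T'(1) by auto
qed

text \<open>Difference quotients in direction h are at most \<open>c * norm h\<close>, and differ
  from the derivative by an error that vanishes with the step length.\<close>

lemma onorm_derivative_le_lipschitz:
  fixes f :: "'a::euclidean_space \<Rightarrow> 'b::real_normed_vector"
  assumes D: "(f has_derivative f') (at x)" and S: "open S" "x \<in> S"
    and lip: "\<And>y. y \<in> S \<Longrightarrow> norm (f y - f x) \<le> c * norm (y - x)"
  shows "onorm f' \<le> c"
proof (rule onorm_le)
  fix h
  interpret bounded_linear f' by (rule has_derivative_bounded_linear[OF D])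
  show "norm (f' h) \<le> c * norm h"
  proof (cases "h = 0")
    case False
    have *: "norm (f' h) \<le> (c + e) * norm h" if "e > 0" for e
    proof -
      obtain d where d: "d > 0" "\<And>y. norm (y - x) < d \<Longrightarrow> norm (f y - f x - f' (y - x)) \<le> e * norm (y - x)"
        using D \<open>e > 0\<close> unfolding has_derivative_at_alt by blast
      obtain d' where d': "d' > 0" "ball x d' \<subseteq> S"
        using S openE by blast
      define t where "t = min d d' / (2 * norm h)"
      have t: "t > 0" "t * norm h < d" "t * norm h < d'" using d d' False by (auto simp: t_def)
      define y where "y = x + t *\<^sub>R h"
      have y: "norm (y - x) = t * norm h" "f' (y - x) = t *\<^sub>R f' h" "y \<in> S"
        using t d'(2) by (auto simp: y_def scaleR dist_norm subset_iff)
      have "norm (f' (y - x)) \<le> norm (f y - f x) + norm (f y - f x - f' (y - x))"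
        by (metis norm_minus_commute norm_triangle_sub)
      then have "t * norm (f' h) \<le> c * (t * norm h) + e * (t * norm h)"
        using d(2)[of y] lip[OF y(3)] y t by simp
      then have "t * norm (f' h) \<le> t * ((c + e) * norm h)" by (simp add: algebra_simps)
      then show ?thesis using t(1) by simp
    qed
    then have "norm (f' h) \<le> c * norm h + e" if "e > 0" for e
      using *[of "e / norm h"] that False by (simp add: distrib_right)
    then show ?thesis by (rule field_le_epsilon)
  qed (simp add: zero)
qed

lemma comp_word_append: "comp_word \<phi> l (u @ v) = comp_word \<phi> l u \<circ> comp_word \<phi> (l + length u) v"
  by (induction u arbitrary: l) (auto simp: o_assoc)

lemma comp_word_snoc: "comp_word \<phi> 1 (u @ [i]) = comp_word \<phi> 1 u \<circ> \<phi> (Suc (length u)) i"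
  by (simp add: comp_word_append)

lemma finite_words_Nil [simp]: "[] \<in> finite_words I"
  by (simp add: finite_words_iff)

lemma finite_words_snoc:
  "u @ [i] \<in> finite_words I \<longleftrightarrow> u \<in> finite_words I \<and> i \<in> I (Suc (length u))"
  by (simp add: finite_words_iff words_snoc_iff del: One_nat_def)

section \<open>Norms of word maps: chain rule, distortion, contraction\<close>

context ncifs
begin

lemma J_nonempty: "J \<noteq> {}"
  using J(2) interior_subset by blast

lemma map_V: "k \<ge> 1 \<Longrightarrow> i \<in> I k \<Longrightarrow> x \<in> V \<Longrightarrow> \<phi> k i x \<in> V"
  using conformal[of k i] by (auto simp: conformal_diffeo_into_def)

lemma map_similar_deriv:
  assumes "k \<ge> 1" "i \<in> I k" "x \<in> V"
  shows "similar_deriv (\<phi> k i) x (deriv_norm (\<phi> k i) x)"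
proof -
  obtain r where r: "similar_deriv (\<phi> k i) x r"
    using conformal[OF assms(1,2)] assms(3) unfolding conformal_diffeo_into_def similar_deriv_def by blast
  then show ?thesis by (simp add: similar_deriv_norm[OF r])
qed

lemma word_similar_deriv:
  "u \<in> finite_words I \<Longrightarrow> x \<in> V \<Longrightarrow> similar_deriv (comp_word \<phi> 1 u) x (deriv_norm (comp_word \<phi> 1 u) x)"
proof (induction u arbitrary: x rule: rev_induct)
  case Nil
  show ?case using similar_deriv_id[of x] by (simp add: similar_deriv_norm[OF similar_deriv_id] del: id_apply)
next
  case (snoc i u)
  then have u: "u \<in> finite_words I" "i \<in> I (Suc (length u))" by (auto simp: finite_words_snoc)
  have *: "similar_deriv (comp_word \<phi> 1 (u @ [i])) x
      (deriv_norm (comp_word \<phi> 1 u) (\<phi> (Suc (length u)) i x) * deriv_norm (\<phi> (Suc (length u)) i) x)"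
    unfolding comp_word_snoc
    by (intro similar_deriv_comp map_similar_deriv snoc.IH u map_V snoc.prems) auto
  then show ?case by (simp only: similar_deriv_norm[OF *])
qed

lemma deriv_norm_snoc:
  assumes "u @ [i] \<in> finite_words I" "x \<in> V"
  shows "deriv_norm (comp_word \<phi> 1 (u @ [i])) x =
     deriv_norm (comp_word \<phi> 1 u) (\<phi> (Suc (length u)) i x) * deriv_norm (\<phi> (Suc (length u)) i) x"
  unfolding comp_word_snoc
  using assms by (intro similar_deriv_norm similar_deriv_comp map_similar_deriv word_similar_deriv map_V)
    (auto simp: finite_words_snoc)

lemma deriv_norm_pos:
  "k \<ge> 1 \<Longrightarrow> i \<in> I k \<Longrightarrow> x \<in> V \<Longrightarrow> deriv_norm (\<phi> k i) x > 0"
  "u \<in> finite_words I \<Longrightarrow> x \<in> V \<Longrightarrow> deriv_norm (comp_word \<phi> 1 u) x > 0"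
  using map_similar_deriv word_similar_deriv by (auto simp: similar_deriv_def)

text \<open>The contraction is assumed on \<open>J\<close> only, so it controls the derivative first
  at interior points; continuity carries the bound to the boundary because \<open>J\<close> is the
  closure of its interior.\<close>

lemma deriv_norm_le_contraction:
  obtains c where "0 < c" "c < 1"
    "\<And>k i x. k \<ge> 1 \<Longrightarrow> i \<in> I k \<Longrightarrow> x \<in> J \<Longrightarrow> deriv_norm (\<phi> k i) x \<le> c"
proof -
  obtain c where c: "0 < c" "c < 1"
    and lip: "\<forall>k\<ge>1. \<forall>i\<in>I k. \<forall>x\<in>J. \<forall>y\<in>J. norm (\<phi> k i x - \<phi> k i y) \<le> c * norm (x - y)"
    using contraction by auto
  have "deriv_norm (\<phi> k i) x \<le> c" if k: "k \<ge> 1" "i \<in> I k" and x: "x \<in> J" for k i x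
  proof -
    obtain f' where f': "\<And>x. x \<in> V \<Longrightarrow> (\<phi> k i has_derivative blinfun_apply (f' x)) (at x)" "continuous_on V f'"
      using conformal[OF k] unfolding conformal_diffeo_into_def C1_on_def by auto
    have eq: "deriv_norm (\<phi> k i) x = norm (f' x)" if "x \<in> V" for x
      by (simp add: deriv_norm_def norm_blinfun.rep_eq frechet_derivative_at[OF f'(1)[OF that], symmetric])
    have "norm (f' x) \<le> c"
    proof (rule continuous_le_on_closure[of "interior J" "\<lambda>x. norm (f' x)"])
      show "continuous_on (closure (interior J)) (\<lambda>x. norm (f' x))"
        unfolding J(3) by (rule continuous_on_norm[OF continuous_on_subset[OF f'(2) V(3)]])
      show "x \<in> closure (interior J)" using x by (simp add: J(3))
      fix z assume z: "z \<in> interior J"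
      then have "z \<in> J" using interior_subset by blast
      have "z \<in> V" using \<open>z \<in> J\<close> V(3) by blast
      have "onorm (blinfun_apply (f' z)) \<le> c"
      proof (rule onorm_derivative_le_lipschitz[OF f'(1)[OF \<open>z \<in> V\<close>] open_interior z])
        fix y assume "y \<in> interior J"
        then have "y \<in> J" using interior_subset by blast
        then show "norm (\<phi> k i y - \<phi> k i z) \<le> c * norm (y - z)" using lip k \<open>z \<in> J\<close> by simp
      qed
      then show "norm (f' z) \<le> c" by (simp add: norm_blinfun.rep_eq)
    qed
    then show ?thesis using eq x V(3) by auto
  qed
  then show thesis by (intro that[OF c(1,2)])
qed

text \<open>Bounded distortion is assumed for nonempty words; the empty word joins them because its
  derivative norm is constantly 1.\<close>

lemma word_distortion:
  obtains C where "C \<ge> 1" "\<And>u x y. u \<in> finite_words I \<Longrightarrow> x \<in> V \<Longrightarrow> y \<in> V \<Longrightarrow>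
    deriv_norm (comp_word \<phi> 1 u) x \<le> C * deriv_norm (comp_word \<phi> 1 u) y"
proof -
  obtain C where C: "C \<ge> 1" "\<And>l k u x y. 1 \<le> l \<Longrightarrow> l \<le> k \<Longrightarrow> u \<in> words I l k \<Longrightarrow> x \<in> V \<Longrightarrow> y \<in> V \<Longrightarrow>
    deriv_norm (comp_word \<phi> l u) x \<le> C * deriv_norm (comp_word \<phi> l u) y"
    using distortion by blast
  have "deriv_norm (comp_word \<phi> 1 u) x \<le> C * deriv_norm (comp_word \<phi> 1 u) y"
    if "u \<in> finite_words I" "x \<in> V" "y \<in> V" for u x y
  proof (cases "u = []")
    case True
    have "deriv_norm id z = 1" for z :: 'a by (rule similar_deriv_norm[OF similar_deriv_id])
    then show ?thesis using C(1) True by simp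
  next
    case False
    then have "1 \<le> length u" by (cases u) auto
    then show ?thesis using C(2)[of 1 "length u" u] that by (simp add: finite_words_iff)
  qed
  then show thesis by (intro that[OF C(1)])
qed

abbreviation N :: "'i list \<Rightarrow> real" where "N \<equiv> word_norm J \<phi>"

lemma bdd_above_deriv_norm: "u \<in> finite_words I \<Longrightarrow> bdd_above (deriv_norm (comp_word \<phi> 1 u) ` J)"
proof -
  assume u: "u \<in> finite_words I"
  obtain j where j: "j \<in> V" using J_nonempty V(3) by auto
  obtain C where "C \<ge> 1" and C: "\<And>u x y. u \<in> finite_words I \<Longrightarrow> x \<in> V \<Longrightarrow> y \<in> V \<Longrightarrow>
    deriv_norm (comp_word \<phi> 1 u) x \<le> C * deriv_norm (comp_word \<phi> 1 u) y"
    using word_distortion by blast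
  show ?thesis
    by (rule bdd_aboveI2) (use C[OF u _ j] V(3) in blast)
qed

lemma deriv_norm_le_word_norm:
  "u \<in> finite_words I \<Longrightarrow> x \<in> J \<Longrightarrow> deriv_norm (comp_word \<phi> 1 u) x \<le> N u"
  unfolding word_norm_def sup_deriv_norm_def by (intro cSUP_upper bdd_above_deriv_norm)

lemma word_norm_pos:
  assumes "u \<in> finite_words I"
  shows "N u > 0"
proof -
  obtain j where "j \<in> J" "j \<in> V" using J_nonempty V(3) by auto
  then show ?thesis
    using deriv_norm_pos(2)[OF assms] deriv_norm_le_word_norm[OF assms] by (meson less_le_trans)
qed

lemma word_norm_Nil: "N [] = 1"
proof -
  have "deriv_norm id x = 1" for x :: 'a by (rule similar_deriv_norm[OF similar_deriv_id])
  then show ?thesis using J_nonempty by (simp add: word_norm_def sup_deriv_norm_def)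
qed

text \<open>The supremum is over \<open>J\<close> but is compared with derivatives at all points of
  \<open>V\<close>, since the mean value inequality is applied on balls that may leave
  \<open>J\<close>.\<close>

lemma word_norm_distortion:
  obtains C where "C \<ge> 1"
    "\<And>u x. u \<in> finite_words I \<Longrightarrow> x \<in> V \<Longrightarrow> N u \<le> C * deriv_norm (comp_word \<phi> 1 u) x"
    "\<And>u x. u \<in> finite_words I \<Longrightarrow> x \<in> V \<Longrightarrow> deriv_norm (comp_word \<phi> 1 u) x \<le> C * N u"
proof -
  obtain C where C: "C \<ge> 1" "\<And>u x y. u \<in> finite_words I \<Longrightarrow> x \<in> V \<Longrightarrow> y \<in> V \<Longrightarrow>
    deriv_norm (comp_word \<phi> 1 u) x \<le> C * deriv_norm (comp_word \<phi> 1 u) y"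
    using word_distortion by blast
  obtain j where j: "j \<in> J" "j \<in> V" using J_nonempty V(3) by auto
  show thesis
  proof (rule that[OF C(1)])
    fix u x assume u: "u \<in> finite_words I" "x \<in> V"
    show "N u \<le> C * deriv_norm (comp_word \<phi> 1 u) x"
      unfolding word_norm_def sup_deriv_norm_def using u V(3) C(2) J_nonempty
      by (intro cSUP_least) auto
    show "deriv_norm (comp_word \<phi> 1 u) x \<le> C * N u"
      using C(2)[OF u j(2)] mult_left_mono[OF deriv_norm_le_word_norm[OF u(1) j(1)], of C] C(1) by linarith
  qed
qed

text \<open>As \<open>\<phi> k i\<close> maps \<open>J\<close> into \<open>J\<close>, both factors
  of the chain rule are evaluated on \<open>J\<close>.\<close>

lemma word_norm_contraction:
  obtains c where "0 < c" "c < 1" "\<And>u i. u @ [i] \<in> finite_words I \<Longrightarrow> N (u @ [i]) \<le> c * N u"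
    "\<And>u. u \<in> finite_words I \<Longrightarrow> N u \<le> c ^ length u"
proof -
  obtain c where c: "0 < c" "c < 1"
    "\<And>k i x. k \<ge> 1 \<Longrightarrow> i \<in> I k \<Longrightarrow> x \<in> J \<Longrightarrow> deriv_norm (\<phi> k i) x \<le> c"
    using deriv_norm_le_contraction by blast
  have step: "N (u @ [i]) \<le> c * N u" if ui: "u @ [i] \<in> finite_words I" for u i
  proof -
    have u: "u \<in> finite_words I" and i: "i \<in> I (Suc (length u))" using ui by (auto simp: finite_words_snoc)
    have "deriv_norm (comp_word \<phi> 1 (u @ [i])) x \<le> N u * c" if x: "x \<in> J" for x
    proof -
      have "\<phi> (Suc (length u)) i x \<in> J" using maps_J[OF _ i] x by auto
      moreover have "x \<in> V" using x V(3) by auto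
      ultimately show ?thesis
        unfolding deriv_norm_snoc[OF ui \<open>x \<in> V\<close>]
        using c(3)[OF _ i x] deriv_norm_pos(1)[OF _ i, of x] word_norm_pos[OF u]
        by (intro mult_mono deriv_norm_le_word_norm u) auto
    qed
    then show ?thesis
      unfolding word_norm_def[of J \<phi> "u @ [i]"] sup_deriv_norm_def using J_nonempty
      by (intro cSUP_least) (auto simp: mult.commute)
  qed
  have "N u \<le> c ^ length u" if "u \<in> finite_words I" for u
    using that
  proof (induction u rule: rev_induct)
    case (snoc i u)
    then have "N u \<le> c ^ length u" by (simp add: finite_words_snoc)
    then show ?case
      using order_trans[OF step[OF snoc.prems] mult_left_mono[of "N u" "c ^ length u" c]] c(1) by simp
  qed (simp add: word_norm_Nil)
  then show thesis by (intro that[OF c(1,2)] step)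
qed

text \<open>Converse of submultiplicativity: by distortion, the first factor of the exact chain rule
  is at least \<open>N u / C\<close> wherever it is evaluated. It limits how far a stopping word
  falls below its parent.\<close>

lemma word_norm_snoc_ge:
  obtains C where "C \<ge> 1" "\<And>u i. u @ [i] \<in> finite_words I \<Longrightarrow>
    N u * sup_deriv_norm J (\<phi> (Suc (length u)) i) \<le> C * N (u @ [i])"
proof -
  obtain C where C: "C \<ge> 1"
    "\<And>u x. u \<in> finite_words I \<Longrightarrow> x \<in> V \<Longrightarrow> N u \<le> C * deriv_norm (comp_word \<phi> 1 u) x"
    "\<And>u x. u \<in> finite_words I \<Longrightarrow> x \<in> V \<Longrightarrow> deriv_norm (comp_word \<phi> 1 u) x \<le> C * N u"
    using word_norm_distortion by blast
  have "N u * sup_deriv_norm J (\<phi> (Suc (length u)) i) \<le> C * N (u @ [i])"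
    if ui: "u @ [i] \<in> finite_words I" for u i
  proof -
    let ?f = "\<phi> (Suc (length u)) i"
    have u: "u \<in> finite_words I" and i: "i \<in> I (Suc (length u))" using ui by (auto simp: finite_words_snoc)
    have "deriv_norm ?f x \<le> C * N (u @ [i]) / N u" if x: "x \<in> J" for x
    proof -
      have x': "x \<in> V" and fx: "?f x \<in> V" using x V(3) map_V[OF _ i] by auto
      have "N u * deriv_norm ?f x \<le> C * deriv_norm (comp_word \<phi> 1 u) (?f x) * deriv_norm ?f x"
        using C(2)[OF u fx] deriv_norm_pos(1)[OF _ i x'] by (intro mult_right_mono) auto
      also have "\<dots> \<le> C * N (u @ [i])"
        using deriv_norm_le_word_norm[OF ui x] C(1) deriv_norm_snoc[OF ui x'] by simp
      finally show ?thesis using word_norm_pos[OF u] by (simp add: pos_le_divide_eq mult.commute)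
    qed
    then have "sup_deriv_norm J ?f \<le> C * N (u @ [i]) / N u"
      unfolding sup_deriv_norm_def using J_nonempty by (intro cSUP_least) auto
    then show ?thesis using word_norm_pos[OF u] by (simp add: pos_le_divide_eq mult.commute)
  qed
  then show thesis by (intro that[OF C(1)])
qed

end

section \<open>Coding map and stopping words\<close>

lemma countable_finite_words:
  assumes "\<And>k. k \<ge> 1 \<Longrightarrow> finite (I k)"
  shows "countable (finite_words I)"
  unfolding finite_words_def
  by (rule countable_UN) (use assms in \<open>auto intro!: countable_finite finite_words_set\<close>)

lemma butlast_word_prefix_Suc: "butlast (word_prefix v (Suc n)) = word_prefix v n"
  by (simp add: word_prefix_Suc)

lemma word_prefix_finite_words: "v \<in> inf_words I \<Longrightarrow> word_prefix v n \<in> finite_words I"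
  using word_prefix_in_words[of v I n] by (auto simp: finite_words_def)

section \<open>Diameters of the pieces, uniformly over all words\<close>

context ncifs
begin

lemma finite_I: "k \<ge> 1 \<Longrightarrow> finite (I k)"
  using index_sets by blast

text \<open>A ball inside \<open>V\<close> is convex, so the mean value inequality applies;
  distortion bounds the derivative on it by \<open>C * N u\<close>, leaving a constant
  \<open>C * r\<close> independent of the word.\<close>

lemma word_lipschitz_locally:
  assumes "x \<in> V"
  obtains T L where "open T" "x \<in> T" "L \<ge> 0"
    "\<forall>u\<in>finite_words I. \<forall>y\<in>T. norm (comp_word \<phi> 1 u x - comp_word \<phi> 1 u y) \<le> L * N u"
proof -
  obtain C where C: "C \<ge> 1"
    "\<And>u x. u \<in> finite_words I \<Longrightarrow> x \<in> V \<Longrightarrow> N u \<le> C * deriv_norm (comp_word \<phi> 1 u) x"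
    "\<And>u x. u \<in> finite_words I \<Longrightarrow> x \<in> V \<Longrightarrow> deriv_norm (comp_word \<phi> 1 u) x \<le> C * N u"
    using word_norm_distortion by blast
  obtain r where r: "r > 0" "ball x r \<subseteq> V" using V(1) assms openE by blast
  have "norm (comp_word \<phi> 1 u x - comp_word \<phi> 1 u y) \<le> C * r * N u"
    if u: "u \<in> finite_words I" and y: "y \<in> ball x r" for u y
  proof -
    let ?f = "comp_word \<phi> 1 u"
    have "norm (?f x - ?f y) \<le> C * N u * norm (x - y)"
    proof (rule differentiable_bound[of "ball x r" ?f "\<lambda>z. frechet_derivative ?f (at z)"])
      fix z assume "z \<in> ball x r"
      then have z: "z \<in> V" using r by auto
      obtain D where "(?f has_derivative D) (at z)"
        using word_similar_deriv[OF u z] unfolding similar_deriv_def by blast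
      then have "(?f has_derivative frechet_derivative ?f (at z)) (at z)"
        by (simp add: frechet_derivative_at[symmetric])
      then show "(?f has_derivative frechet_derivative ?f (at z)) (at z within ball x r)"
        by (rule has_derivative_at_withinI)
      show "onorm (frechet_derivative ?f (at z)) \<le> C * N u"
        using C(3)[OF u z] by (simp add: deriv_norm_def)
    qed (use r y in auto)
    also have "\<dots> \<le> C * N u * r"
      using y C(1) word_norm_pos[OF u] by (intro mult_left_mono) (auto simp: dist_norm)
    finally show ?thesis by (simp add: mult_ac)
  qed
  then show thesis using r C(1) by (intro that[of "ball x r" "C * r"]) auto
qed

text \<open>
  \<open>J\<close> need not be convex, so the mean value inequality only applies in small balls; two points of
  \<open>V\<close> are related through a chain of such balls, and compactness makes the constant uniform.
\<close>

lemma word_diameter: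
  obtains L where "L > 0" "\<forall>u\<in>finite_words I. \<forall>x\<in>J. \<forall>y\<in>J.
    norm (comp_word \<phi> 1 u x - comp_word \<phi> 1 u y) \<le> L * N u"
proof -
  \<comment> \<open>Uniform in the words. Being related for some \<open>L\<close> is an equivalence
    relation with classes open in \<open>V\<close>, so connectedness leaves a single class.\<close>
  define R where "R x y L \<longleftrightarrow>
    (\<forall>u\<in>finite_words I. norm (comp_word \<phi> 1 u x - comp_word \<phi> 1 u y) \<le> L * N u)" for x y and L :: real
  have R_trans: "R x z (L + L')" if "R x y L" "R y z L'" for x y z L L'
    unfolding R_def
  proof
    fix u assume "u \<in> finite_words I"
    then have "norm (comp_word \<phi> 1 u x - comp_word \<phi> 1 u y) \<le> L * N u"
        "norm (comp_word \<phi> 1 u y - comp_word \<phi> 1 u z) \<le> L' * N u"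
      using that by (auto simp: R_def)
    then show "norm (comp_word \<phi> 1 u x - comp_word \<phi> 1 u z) \<le> (L + L') * N u"
      unfolding distrib_right by (rule norm_diff_triangle_le)
  qed
  have R_sym: "R x y L \<Longrightarrow> R y x L" for x y L
    by (simp add: R_def norm_minus_commute)
  have local: "\<exists>T L. open T \<and> x \<in> T \<and> L \<ge> 0 \<and> (\<forall>y\<in>T. R x y L)" if "x \<in> V" for x
    using word_lipschitz_locally[OF that] unfolding R_def by metis
  obtain j where j: "j \<in> J" "j \<in> V" using J_nonempty V(3) by auto
  have connect: "\<exists>L. R j x L" if "x \<in> V" for x
  proof (rule connected_equivalence_relation[OF V(2) j(2) that, where R = "\<lambda>x y. \<exists>L. R x y L"])
    fix x assume "x \<in> V"
    then obtain T L where "open T" "x \<in> T" "\<forall>y\<in>T. R x y L" using local by blast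
    then show "\<exists>T. openin (top_of_set V) T \<and> x \<in> T \<and> (\<forall>y\<in>T. \<exists>L. R x y L)"
      using \<open>x \<in> V\<close> by (intro exI[of _ "V \<inter> T"]) auto
  qed (use R_trans R_sym in blast)+
  have "\<forall>x\<in>J. \<exists>T L. open T \<and> x \<in> T \<and> (\<forall>y\<in>T. R j y L)"
    using local connect V(3) R_trans by (meson subsetD)
  then obtain T L where T: "\<And>x. x \<in> J \<Longrightarrow> open (T x) \<and> x \<in> T x \<and> (\<forall>y\<in>T x. R j y (L x))"
    by metis
  obtain D where D: "D \<subseteq> J" "finite D" "J \<subseteq> (\<Union>x\<in>D. T x)"
    by (rule compactE_image[OF J(1), of J T]) (use T in auto)
  \<comment> \<open>Makes the constants of the finite subcover uniform; absolute values because
    their signs are unknown, and 1 to keep \<open>M\<close> positive.\<close>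
  define M where "M = (\<Sum>x\<in>D. \<bar>L x\<bar>) + 1"
  have "0 \<le> (\<Sum>x\<in>D. \<bar>L x\<bar>)" by (rule sum_nonneg) simp
  then have "M > 0" unfolding M_def by linarith
  have RM: "R j y M" if y: "y \<in> J" for y
  proof -
    obtain x where x: "x \<in> D" "R j y (L x)" using y D T by blast
    have "\<bar>L x\<bar> \<le> (\<Sum>x\<in>D. \<bar>L x\<bar>)" using x D(2) by (intro member_le_sum) auto
    then have "L x \<le> M" unfolding M_def by linarith
    then have "L x * N u \<le> M * N u" if "u \<in> finite_words I" for u
      using word_norm_pos[OF that] by simp
    then show ?thesis using x(2) order_trans unfolding R_def by blast
  qed
  show thesis
  proof (rule that)
    show "M + M > 0" using \<open>M > 0\<close> by simp
    show "\<forall>u\<in>finite_words I. \<forall>x\<in>J. \<forall>y\<in>J.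
        norm (comp_word \<phi> 1 u x - comp_word \<phi> 1 u y) \<le> (M + M) * N u"
      using R_trans[OF R_sym[OF RM] RM] unfolding R_def by blast
  qed
qed

text \<open>Translations preserve distances, so the pieces inherit the estimate for the word
  maps.\<close>

lemma Jw_diameter:
  obtains L where "L > 0"
    "\<forall>u\<in>finite_words I. \<forall>x\<in>Jw u. \<forall>y\<in>Jw u. norm (x - y) \<le> L * N u"
proof -
  obtain L where L: "L > 0" "\<forall>u\<in>finite_words I. \<forall>x\<in>J. \<forall>y\<in>J.
    norm (comp_word \<phi> 1 u x - comp_word \<phi> 1 u y) \<le> L * N u"
    using word_diameter by blast
  have "norm (x - y) \<le> L * N u" if u: "u \<in> finite_words I" and xy: "x \<in> Jw u" "y \<in> Jw u" for u x y
  proof -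
    obtain \<omega> where "Jw u = (\<lambda>x. comp_word \<phi> 1 u x + \<omega>) ` J" using translate[OF u] by blast
    then show ?thesis using xy L(2) u by auto
  qed
  then show thesis using L(1) that by blast
qed

section \<open>The coding map\<close>

lemma Jw_prefix:
  assumes v: "v \<in> inf_words I"
  shows "compact (Jw (word_prefix v n))" "Jw (word_prefix v n) \<noteq> {}" "Jw (word_prefix v n) \<subseteq> J"
    "m \<le> n \<Longrightarrow> Jw (word_prefix v n) \<subseteq> Jw (word_prefix v m)"
proof -
  have u: "word_prefix v n \<in> finite_words I" for n by (rule word_prefix_finite_words[OF v])
  then show "Jw (word_prefix v n) \<subseteq> J" using Jw(1) by blast
  then show "compact (Jw (word_prefix v n))"
    using Jw(1)[OF u] J(1) by (metis compact_Int_closed inf.absorb_iff2)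
  show "Jw (word_prefix v n) \<noteq> {}" using translate[OF u[of n]] J_nonempty by auto
  have "Jw (word_prefix v (Suc n)) \<subseteq> Jw (word_prefix v n)" for n
    unfolding word_prefix_Suc using word_prefix_in_words[OF v, of n] v
    by (intro nested[of "Suc n"]) (auto simp: inf_words_def PiE_iff)
  then show "m \<le> n \<Longrightarrow> Jw (word_prefix v n) \<subseteq> Jw (word_prefix v m)"
    by (rule lift_Suc_antimono_le[of "\<lambda>n. Jw (word_prefix v n)"])
qed

lemma word_norm_prefix_small:
  assumes "e > 0"
  obtains n where "\<And>v. v \<in> inf_words I \<Longrightarrow> N (word_prefix v n) < e"
proof -
  obtain c where c: "0 < c" "c < 1" and "\<And>u i. u @ [i] \<in> finite_words I \<Longrightarrow> N (u @ [i]) \<le> c * N u"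
    and N: "\<And>u. u \<in> finite_words I \<Longrightarrow> N u \<le> c ^ length u"
    using word_norm_contraction by blast
  obtain n where n: "c ^ n < e" using real_arch_pow_inv[OF assms c(2)] by blast
  then show thesis
    using N[OF word_prefix_finite_words, of _ n] by (intro that[of n]) (fastforce intro: le_less_trans)
qed

text \<open>\<open>coding\<close> uses \<open>the_elem\<close>, so the intersection must be a
  singleton: nested nonempty compact sets meet, and their diameters tend to 0.\<close>

lemma coding_in_Jw:
  assumes v: "v \<in> inf_words I"
  shows "coding Jw v \<in> Jw (word_prefix v n)"
proof -
  let ?S = "\<Inter>n\<in>{1..}. Jw (word_prefix v n)"
  have "(\<Inter>n. Jw (word_prefix v n)) \<noteq> {}"
    by (rule compact_nest) (use Jw_prefix[OF v] in auto)
  then obtain x where x: "\<And>n. x \<in> Jw (word_prefix v n)" by auto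
  obtain L where L: "L > 0" "\<forall>u\<in>finite_words I. \<forall>x\<in>Jw u. \<forall>y\<in>Jw u. norm (x - y) \<le> L * N u"
    using Jw_diameter by blast
  have "y = x" if y: "y \<in> ?S" for y
  proof (rule ccontr)
    assume "y \<noteq> x"
    then have "norm (y - x) / L > 0" using L(1) by simp
    then obtain n where n: "\<And>v. v \<in> inf_words I \<Longrightarrow> N (word_prefix v n) < norm (y - x) / L"
      using word_norm_prefix_small by blast
    \<comment> \<open>The intersection starts at level 1; going through \<open>max 1 n\<close>
      covers n = 0 by nesting.\<close>
    have "y \<in> Jw (word_prefix v n)"
      using y Jw_prefix(4)[OF v, of n "max 1 n"] by (auto simp: subset_iff)
    then have "norm (y - x) \<le> L * N (word_prefix v n)"
      using L(2) x word_prefix_finite_words[OF v] by blast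
    then show False using n[OF v] L(1) by (simp add: field_simps)
  qed
  then have "?S = {x}" using x by auto
  then show ?thesis using x by (simp add: coding_def)
qed

lemma coding_cylinder:
  assumes "v \<in> cylinder I u"
  shows "coding Jw v \<in> Jw u"
proof -
  have "v \<in> inf_words I" "word_prefix v (length u) = u" using assms by (auto simp: cylinder_def)
  then show ?thesis using coding_in_Jw[of v "length u"] by simp
qed

lemma coding_in_J: "v \<in> inf_words I \<Longrightarrow> coding Jw v \<in> J"
  using coding_in_Jw[of v 0] Jw(2) by simp

text \<open>The preimage of an open set is the union of those cylinders whose pieces lie in the set,
  and there are only countably many words.\<close>

lemma coding_measurable: "coding Jw \<in> borel_measurable (borel_words I)"
proof (rule borel_measurableI)
  fix S :: "'a set" assume "open S"
  obtain L where L: "L > 0" "\<forall>u\<in>finite_words I. \<forall>x\<in>Jw u. \<forall>y\<in>Jw u. norm (x - y) \<le> L * N u"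
    using Jw_diameter by blast
  have "coding Jw -` S \<inter> inf_words I = (\<Union>u\<in>{u\<in>finite_words I. Jw u \<subseteq> S}. cylinder I u)" (is "?A = ?B")
  proof
    show "?B \<subseteq> ?A" using coding_cylinder by (auto simp: cylinder_def)
    show "?A \<subseteq> ?B"
    proof
      fix v assume v: "v \<in> ?A"
      then obtain r where r: "r > 0" "ball (coding Jw v) r \<subseteq> S" using \<open>open S\<close> openE by blast
      have "r / L > 0" using r(1) L(1) by simp
      then obtain n where n: "\<And>v. v \<in> inf_words I \<Longrightarrow> N (word_prefix v n) < r / L"
        using word_norm_prefix_small by blast
      define u where "u = word_prefix v n"
      have u: "u \<in> finite_words I" using v by (simp add: u_def word_prefix_finite_words)
      have "Jw u \<subseteq> ball (coding Jw v) r"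
      proof
        fix x assume "x \<in> Jw u"
        moreover have "coding Jw v \<in> Jw u" using v by (simp add: u_def coding_in_Jw)
        ultimately have "norm (coding Jw v - x) \<le> L * N u" using L(2) u by blast
        also have "\<dots> < r" using n[of v] v L(1) by (simp add: u_def field_simps)
        finally show "x \<in> ball (coding Jw v) r" by (simp add: dist_norm)
      qed
      moreover have "v \<in> cylinder I u" using v by (simp add: cylinder_def u_def)
      ultimately show "v \<in> ?B" using u r(2) by blast
    qed
  qed
  moreover have "?B \<in> sets (borel_words I)"
    using countable_finite_words[OF finite_I] by (intro sets.countable_UN'') (auto intro: countable_subset)
  ultimately show "coding Jw -` S \<inter> space (borel_words I) \<in> sets (borel_words I)" by simp
qed

section \<open>The partition by stopping words\<close>

lemma stopping_wordsD:
  assumes "u \<in> stopping_words J I \<phi> \<delta>"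
  obtains w i where "u = w @ [i]" "w \<in> finite_words I" "i \<in> I (Suc (length w))"
    "u \<in> finite_words I" "N u \<le> \<delta>" "\<delta> < N w"
proof -
  have u: "u \<in> finite_words I" "u \<noteq> []" "N u \<le> \<delta>" "\<delta> < N (butlast u)"
    using assms by (auto simp: stopping_words_def)
  then obtain w i where "u = w @ [i]" by (metis append_butlast_last_id)
  with u show thesis by (intro that[of w i]) (auto simp: finite_words_snoc)
qed

text \<open>The parent of a stopping word has norm above \<delta> while norms decay geometrically,
  so lengths are bounded, and each length has finitely many words.\<close>

lemma finite_stopping_words:
  assumes "\<delta> > 0"
  shows "finite (stopping_words J I \<phi> \<delta>)"
proof -
  obtain c where c: "0 < c" "c < 1" and "\<And>u i. u @ [i] \<in> finite_words I \<Longrightarrow> N (u @ [i]) \<le> c * N u"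
    and N: "\<And>u. u \<in> finite_words I \<Longrightarrow> N u \<le> c ^ length u"
    using word_norm_contraction by blast
  obtain n where n: "c ^ n < \<delta>" using real_arch_pow_inv[OF assms c(2)] by blast
  have "stopping_words J I \<phi> \<delta> \<subseteq> (\<Union>k\<le>n. words I 1 k)"
  proof
    fix u assume "u \<in> stopping_words J I \<phi> \<delta>"
    then obtain w i where w: "u = w @ [i]" "w \<in> finite_words I" "i \<in> I (Suc (length w))"
      "u \<in> finite_words I" "N u \<le> \<delta>" "\<delta> < N w" by (rule stopping_wordsD)
    have "c ^ n < c ^ length w" using n w(6) N[OF w(2)] by linarith
    then have "length w < n" using c power_decreasing[of n "length w" c] by (meson less_imp_le not_le)
    then have "length u \<in> {..n}" using w(1) by simp
    then show "u \<in> (\<Union>k\<le>n. words I 1 k)" using w(4)[unfolded finite_words_iff] by (rule UN_I)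
  qed
  moreover have "finite (words I 1 k)" for k
    by (rule finite_words_set) (rule finite_I)
  then have "finite (\<Union>k\<le>n. words I 1 k)" by simp
  ultimately show ?thesis by (rule finite_subset)
qed

lemma word_norm_prefix_antimono:
  assumes v: "v \<in> inf_words I" and "m \<le> n"
  shows "N (word_prefix v n) \<le> N (word_prefix v m)"
proof -
  obtain c where c: "0 < c" "c < 1" and N: "\<And>u i. u @ [i] \<in> finite_words I \<Longrightarrow> N (u @ [i]) \<le> c * N u"
    and "\<And>u. u \<in> finite_words I \<Longrightarrow> N u \<le> c ^ length u"
    using word_norm_contraction by blast
  have "N (word_prefix v (Suc n)) \<le> N (word_prefix v n)" for n
  proof -
    have "N (word_prefix v (Suc n)) \<le> c * N (word_prefix v n)"
      unfolding word_prefix_Suc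
      by (rule N) (use word_prefix_finite_words[OF v, of "Suc n"] in \<open>simp add: word_prefix_Suc\<close>)
    also have "\<dots> \<le> N (word_prefix v n)"
      using c word_norm_pos[OF word_prefix_finite_words[OF v, of n]] by simp
    finally show ?thesis .
  qed
  then show ?thesis using \<open>m \<le> n\<close> by (rule lift_Suc_antimono_le[of "\<lambda>n. N (word_prefix v n)"])
qed

text \<open>Stop at the first prefix of norm at most \<delta>; \<delta> < 1 = \<open>N []\<close>
  ensures that this prefix is nonempty, so it has a parent.\<close>

lemma stopping_words_cover:
  assumes "0 < \<delta>" "\<delta> < 1" and v: "v \<in> inf_words I"
  shows "\<exists>u\<in>stopping_words J I \<phi> \<delta>. v \<in> cylinder I u"
proof -
  obtain n where "N (word_prefix v n) < \<delta>"
    using word_norm_prefix_small[OF assms(1)] v by blast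
  then have ex: "N (word_prefix v n) \<le> \<delta>" by simp
  define k where "k = (LEAST n. N (word_prefix v n) \<le> \<delta>)"
  have k: "N (word_prefix v k) \<le> \<delta>" unfolding k_def by (rule LeastI[of _ n]) (rule ex)
  then have "k \<noteq> 0" using assms(2) by (intro notI) (simp add: word_norm_Nil)
  then obtain j where j: "k = Suc j" by (cases k) auto
  have "\<not> N (word_prefix v j) \<le> \<delta>"
    by (rule not_less_Least[of j "\<lambda>n. N (word_prefix v n) \<le> \<delta>"]) (simp add: k_def[symmetric] j)
  then have "word_prefix v k \<in> stopping_words J I \<phi> \<delta>"
    using k word_prefix_finite_words[OF v, of k] unfolding j stopping_words_def
    by (simp add: butlast_word_prefix_Suc) (simp add: word_prefix_Suc)
  moreover have "v \<in> cylinder I (word_prefix v k)" using v by (simp add: cylinder_def)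
  ultimately show ?thesis by blast
qed

text \<open>Of two stopping prefixes with different lengths, the parent of the longer would still
  have the shorter as a prefix, and so norm at most \<delta>.\<close>

lemma stopping_words_disjoint:
  assumes u: "u \<in> stopping_words J I \<phi> \<delta>" "v \<in> cylinder I u"
    and u': "u' \<in> stopping_words J I \<phi> \<delta>" "v \<in> cylinder I u'"
  shows "u = u'"
proof -
  have v: "v \<in> inf_words I" using u by (simp add: cylinder_def)
  have *: "length u' \<le> length u" if u: "u \<in> stopping_words J I \<phi> \<delta>" "v \<in> cylinder I u"
    and u': "u' \<in> stopping_words J I \<phi> \<delta>" "v \<in> cylinder I u'" for u u'
  proof (rule ccontr)
    assume "\<not> ?thesis"
    then obtain n where n: "length u' = Suc n" "length u \<le> n" by (cases "length u'") auto
    then have "butlast u' = word_prefix v n"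
      using u'(2) butlast_word_prefix_Suc[of v n] by (simp add: cylinder_def)
    then have "\<delta> < N (word_prefix v n)" using u'(1) by (simp add: stopping_words_def)
    moreover have "N (word_prefix v n) \<le> N u"
      using word_norm_prefix_antimono[OF v n(2)] u(2) by (simp add: cylinder_def)
    ultimately show False using u(1) by (simp add: stopping_words_def)
  qed
  have "length u = length u'" using *[OF u u'] *[OF u' u] by simp
  then show ?thesis using u(2) u'(2) by (simp add: cylinder_def)
qed

end

section \<open>Pressure and the size of stopping words\<close>

text \<open>Here \<open>l\<close> stands for \<open>ln \<delta>\<close> and \<open>n\<close> for the
  word norms. The term \<open>e * \<bar>t\<bar>\<close> serves both signs of t: the lower bound on
  \<open>ln (n u)\<close> decides for t \<ge> 0, the upper bound for t < 0. Thus each power of a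
  norm can be replaced by one common factor.\<close>

lemma log_moment_ge_of_pressure_neg:
  fixes p n :: "'u \<Rightarrow> real"
  assumes U: "finite U" "\<And>u. u \<in> U \<Longrightarrow> p u \<ge> 0"
    and m: "(\<Sum>u\<in>U. p u) > 0" "q = 1 \<Longrightarrow> (\<Sum>u\<in>U. p u) \<le> 1"
    and n: "\<And>u. u \<in> U \<Longrightarrow> n u > 0" "\<And>u. u \<in> U \<Longrightarrow> (1 + e) * l \<le> ln (n u)"
      "\<And>u. u \<in> U \<Longrightarrow> ln (n u) \<le> l"
    and l: "l < 0" "e \<ge> 0"
    and neg: "(if q = 1 then - (\<Sum>u\<in>U. p u * ln (n u powr (- t) * p u))
      else sgn (1 - q) * ln (\<Sum>u\<in>U. n u powr (t * (1 - q)) * p u powr q)) < 0"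
  shows "(t + e * \<bar>t\<bar>) * l \<le> log_moment q U p"
proof -
  define w where "w = (t + e * \<bar>t\<bar>) * l"
  have w: "w \<le> t * ln (n u)" if u: "u \<in> U" for u
  proof (cases "t \<ge> 0")
    case True
    then show ?thesis using mult_left_mono[OF n(2)[OF u] True] by (simp add: w_def algebra_simps)
  next
    case False
    then have "t * l \<le> t * ln (n u)" using n(3)[OF u] by simp
    moreover have "e * \<bar>t\<bar> * l \<le> 0" using l by (intro mult_nonneg_nonpos) auto
    then have "w \<le> t * l" by (simp add: w_def distrib_right)
    ultimately show ?thesis by simp
  qed
  show ?thesis
  proof (cases "q = 1")
    case True
    have le1: "p u \<le> 1" if "u \<in> U" for u
      using member_le_sum[of u U p] U that m(2)[OF True] by simp
    have "p u * ln (n u powr (- t) * p u) = p u * ln (p u) - p u * (t * ln (n u))" if "u \<in> U" for u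
      using U(2)[OF that] n(1)[OF that] by (cases "p u = 0") (auto simp: ln_mult algebra_simps)
    then have "(\<Sum>u\<in>U. p u * ln (n u powr (- t) * p u)) =
        (\<Sum>u\<in>U. p u * ln (p u)) - (\<Sum>u\<in>U. p u * (t * ln (n u)))"
      by (simp add: sum_subtractf)
    then have gt: "(\<Sum>u\<in>U. p u * ln (p u)) > (\<Sum>u\<in>U. p u * (t * ln (n u)))"
      using neg True by simp
    \<comment> \<open>Masses at most 1 make every \<open>p u * ln (p u)\<close> nonpositive, so a
      negative t would contradict the sign condition. Then \<open>w\<close> is nonpositive, and
      multiplying it by a total mass at most 1 can only increase it.\<close>
    have "t \<ge> 0"
    proof (rule ccontr)
      assume "\<not> t \<ge> 0"
      then have "t * ln (n u) \<ge> 0" if "u \<in> U" for u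
        using n(3)[OF that] l by (intro mult_nonpos_nonpos) auto
      then have "(\<Sum>u\<in>U. p u * (t * ln (n u))) \<ge> 0"
        using U(2) by (intro sum_nonneg) simp
      moreover have "p u * ln (p u) \<le> 0" if "u \<in> U" for u
        using U(2)[OF that] le1[OF that] by (cases "p u = 0") (auto simp: mult_le_0_iff)
      then have "(\<Sum>u\<in>U. p u * ln (p u)) \<le> 0" by (rule sum_nonpos)
      ultimately show False using gt by linarith
    qed
    then have "w \<le> 0" using l by (simp add: w_def mult_le_0_iff)
    then have "w \<le> (\<Sum>u\<in>U. p u) * w"
      using m by (smt (verit) mult_right_mono_neg True mult_cancel_right1)
    also have "\<dots> \<le> (\<Sum>u\<in>U. p u * (t * ln (n u)))"
      unfolding sum_distrib_right using w U(2) by (intro sum_mono mult_left_mono)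
    finally show ?thesis using gt True by (simp add: log_moment_def w_def)
  next
    case False
    define A B where "A = (\<Sum>u\<in>U. p u powr q)"
      and "B = (\<Sum>u\<in>U. n u powr (t * (1 - q)) * p u powr q)"
    have A: "A > 0" unfolding A_def by (rule powr_sum_pos[OF U(1) m(1)])
    have "sgn (1 - q) * (exp ((1 - q) * w) * A) \<le> sgn (1 - q) * B"
      unfolding A_def B_def sum_distrib_left
    proof (rule sum_mono)
      fix u assume u: "u \<in> U"
      have "n u powr (t * (1 - q)) = exp ((1 - q) * (t * ln (n u)))"
        using n(1)[OF u] by (simp add: powr_def mult_ac)
      then have "sgn (1 - q) * exp ((1 - q) * w) \<le> sgn (1 - q) * n u powr (t * (1 - q))"
        using w[OF u] by (auto simp: sgn_if mult_left_mono mult_left_mono_neg)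
      then show "sgn (1 - q) * (exp ((1 - q) * w) * p u powr q)
          \<le> sgn (1 - q) * (n u powr (t * (1 - q)) * p u powr q)"
        by (metis mult.assoc mult_right_mono powr_ge_zero)
    qed
    \<comment> \<open>The sign condition means B < 1 for q < 1 and B > 1 for q > 1; B = 0 is
      excluded because \<open>ln 0 = 0\<close> is not strictly negative.\<close>
    moreover have "sgn (1 - q) * B < sgn (1 - q)"
    proof -
      have "B \<ge> 0" unfolding B_def by (intro sum_nonneg) simp
      moreover have "sgn (1 - q) * ln B < 0" using neg False by (simp add: B_def)
      ultimately show ?thesis
        using False ln_ge_zero[of B] by (cases "B = 0") (auto simp: sgn_if not_less split: if_splits)
    qed
    ultimately have "sgn (1 - q) * (exp ((1 - q) * w) * A) \<le> sgn (1 - q) * 1" by simp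
    then have "sgn (1 - q) * ln (exp ((1 - q) * w) * A) \<le> 0"
      using A False by (auto simp: sgn_if split: if_splits)
    then have "sgn (1 - q) * ((1 - q) * w + ln A) \<le> 0" using A by (simp add: ln_mult)
    then have "w \<le> ln A / (q - 1)"
      using False by (auto simp: sgn_if field_simps split: if_splits)
    then show ?thesis using False by (simp add: log_moment_def A_def w_def)
  qed
qed

text \<open>One implication at each scale serves both limits. For the lower one it is used
  contrapositively: if \<open>D\<close> were eventually above t + e, \<open>P\<close> would
  eventually be nonnegative.\<close>

lemma Liminf_Limsup_le_of_neg:
  fixes D :: "real \<Rightarrow> ereal" and P :: "real \<Rightarrow> real"
  assumes le: "\<And>e::real. e > 0 \<Longrightarrow> eventually (\<lambda>\<delta>. P \<delta> < 0 \<longrightarrow> D \<delta> \<le> ereal (t + e)) F"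
  shows "Liminf F (\<lambda>\<delta>. ereal (P \<delta>)) < 0 \<Longrightarrow> Liminf F D \<le> ereal t"
    and "Limsup F (\<lambda>\<delta>. ereal (P \<delta>)) < 0 \<Longrightarrow> Limsup F D \<le> ereal t"
proof -
  assume neg: "Liminf F (\<lambda>\<delta>. ereal (P \<delta>)) < 0"
  have "Liminf F D \<le> ereal t + ereal e" if "e > 0" for e :: real
  proof (rule ccontr)
    assume "\<not> ?thesis"
    then have "ereal (t + e) < Liminf F D" by simp
    then have "eventually (\<lambda>\<delta>. ereal (t + e) < D \<delta>) F" by (rule less_LiminfD)
    with le[OF that] have "eventually (\<lambda>\<delta>. 0 \<le> ereal (P \<delta>)) F"
    proof eventually_elim
      case (elim \<delta>)
      then have "\<not> P \<delta> < 0" by (meson leD)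
      then show ?case by simp
    qed
    then have "0 \<le> Liminf F (\<lambda>\<delta>. ereal (P \<delta>))" by (rule Liminf_bounded)
    with neg show False by simp
  qed
  then show "Liminf F D \<le> ereal t" by (rule ereal_le_epsilon2)
next
  assume neg: "Limsup F (\<lambda>\<delta>. ereal (P \<delta>)) < 0"
  have "Limsup F D \<le> ereal t + ereal e" if "e > 0" for e :: real
  proof -
    have "eventually (\<lambda>\<delta>. ereal (P \<delta>) < 0) F" using neg by (rule Limsup_lessD)
    with le[OF that] have "eventually (\<lambda>\<delta>. D \<delta> \<le> ereal (t + e)) F"
      by eventually_elim auto
    then show ?thesis by (simp add: Limsup_bounded)
  qed
  then show "Limsup F D \<le> ereal t" by (rule ereal_le_epsilon2)
qed

lemma eventually_divide_ln_small:
  fixes K e :: real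
  assumes "e > 0"
  shows "eventually (\<lambda>\<delta>. K / ln \<delta> < e) (at_right 0)"
proof -
  have "((\<lambda>\<delta>. K / ln \<delta>) \<longlongrightarrow> 0) (at_right 0)"
    by (rule tendsto_divide_0[OF tendsto_const filterlim_at_bot_imp_at_infinity[OF ln_at_0]])
  then show ?thesis using assms by (rule order_tendstoD)
qed

context ncifs
begin

lemma min_norm_pos:
  assumes "k \<ge> 1"
  shows "min_norm J I \<phi> k > 0"
proof -
  have "sup_deriv_norm J (\<phi> k i) > 0" if i: "i \<in> I k" for i
  proof -
    obtain c where c: "\<And>x. x \<in> J \<Longrightarrow> deriv_norm (\<phi> k i) x \<le> c"
      using deriv_norm_le_contraction assms i by metis
    obtain j where j: "j \<in> J" "j \<in> V" using J_nonempty V(3) by auto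
    have "bdd_above (deriv_norm (\<phi> k i) ` J)" by (rule bdd_aboveI2) (rule c)
    then have "deriv_norm (\<phi> k i) j \<le> sup_deriv_norm J (\<phi> k i)"
      unfolding sup_deriv_norm_def using j(1) by (intro cSUP_upper)
    then show ?thesis using deriv_norm_pos(1)[OF assms i j(2)] by linarith
  qed
  moreover have "I k \<noteq> {}" using index_sets[OF assms] by auto
  ultimately show ?thesis using finite_I[OF assms] by (simp add: min_norm_def)
qed

text \<open>The finitely many words of length at most k have norms bounded away from 0, so none of
  them stops at small \<delta>. This makes limits in k usable as \<delta> tends to 0.\<close>

lemma eventually_length_stopping_words:
  "eventually (\<lambda>\<delta>. \<forall>u\<in>stopping_words J I \<phi> \<delta>. k < length u) (at_right 0)"
proof -
  define S where "S = (\<Union>n\<le>k. words I 1 n)"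
  have fin: "finite S" unfolding S_def
    by (intro finite_UN_I finite_words_set finite_atMost) (rule finite_I)
  have S: "u \<in> S \<Longrightarrow> u \<in> finite_words I" for u by (auto simp: S_def finite_words_def)
  define b where "b = Min (insert 1 (N ` S))"
  have "b > 0" using fin S word_norm_pos by (simp add: b_def)
  have "\<forall>u\<in>stopping_words J I \<phi> \<delta>. k < length u" if "\<delta> < b" for \<delta>
  proof (intro ballI, rule ccontr)
    fix u assume u: "u \<in> stopping_words J I \<phi> \<delta>" and "\<not> k < length u"
    then have "u \<in> S" unfolding S_def
      by (intro UN_I[of "length u"]) (auto simp: stopping_words_def finite_words_iff)
    then have "b \<le> N u" unfolding b_def using fin by (intro Min_le) auto
    then show False using u that by (simp add: stopping_words_def)
  qed
  moreover have "eventually (\<lambda>\<delta>. \<delta> < b) (at_right 0)"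
    using \<open>b > 0\<close> by (rule order_tendstoD(2)[OF tendsto_ident_at])
  ultimately show ?thesis by (simp add: eventually_mono)
qed

text \<open>For a stopping word u of length k, the norm of the parent exceeds \<delta>, so
  \<open>C * N u\<close> is at least \<delta> times the least norm at level k. By hypothesis that
  least norm exceeds the h-th power of the largest word norm, hence of \<open>N u\<close>; solving
  gives (1 - h) ln (N u) \<ge> ln \<delta> - ln C.\<close>

lemma eventually_stopping_norm_lower:
  assumes H: "(\<lambda>k. ln (min_norm J I \<phi> k) / ln (max_norm J I \<phi> k)) \<longlonglongrightarrow> 0" and "e > 0"
  shows "eventually (\<lambda>\<delta>. \<forall>u\<in>stopping_words J I \<phi> \<delta>. (1 + e) * ln \<delta> \<le> ln (N u)) (at_right 0)"
proof -
  obtain C where C: "C \<ge> 1" "\<And>u i. u @ [i] \<in> finite_words I \<Longrightarrow>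
    N u * sup_deriv_norm J (\<phi> (Suc (length u)) i) \<le> C * N (u @ [i])"
    using word_norm_snoc_ge by blast
  obtain c where c: "0 < c" "c < 1" and "\<And>u i. u @ [i] \<in> finite_words I \<Longrightarrow> N (u @ [i]) \<le> c * N u"
    and Nc: "\<And>u. u \<in> finite_words I \<Longrightarrow> N u \<le> c ^ length u"
    using word_norm_contraction by blast
  \<comment> \<open>Solves 1 / (1 - h) = 1 + e / 2; the other e / 2 absorbs the distortion
    constant.\<close>
  define h where "h = e / (2 + e)"
  have h: "0 < h" "h < 1" and eh: "(1 + e / 2) * (1 - h) = 1" using \<open>e > 0\<close> by (auto simp: h_def field_simps)
  obtain k0 where k0: "\<And>k. k \<ge> k0 \<Longrightarrow> ln (min_norm J I \<phi> k) / ln (max_norm J I \<phi> k) < h"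
    using order_tendstoD(2)[OF H h(1)] unfolding eventually_sequentially by blast
  have "eventually (\<lambda>\<delta>. - (1 + e / 2) * ln C / ln \<delta> < e / 2) (at_right 0)"
    by (rule eventually_divide_ln_small) (use \<open>e > 0\<close> in simp)
  moreover have "eventually (\<lambda>\<delta>::real. \<delta> < 1) (at_right 0)"
    by (rule order_tendstoD(2)[OF tendsto_ident_at]) simp
  ultimately show ?thesis
    using eventually_length_stopping_words[of k0] eventually_at_right_less[of 0]
  proof eventually_elim
    case (elim \<delta>)
    have \<delta>: "ln \<delta> < 0" using elim by simp
    show ?case
    proof
      fix u assume us: "u \<in> stopping_words J I \<phi> \<delta>"
      then obtain w i where u: "u = w @ [i]" "w \<in> finite_words I" "i \<in> I (Suc (length w))"
        "u \<in> finite_words I" "N u \<le> \<delta>" "\<delta> < N w" by (rule stopping_wordsD)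
      define k where "k = length u"
      have k: "k0 \<le> k" "1 \<le> k" "k = Suc (length w)" using elim us u(1) by (auto simp: k_def)
      have uk: "u \<in> words I 1 k" using u(4) by (simp add: finite_words_iff k_def)
      have finw: "finite (words I 1 k)" by (rule finite_words_set) (rule finite_I)
      have Npos: "N u > 0" by (rule word_norm_pos[OF u(4)])
      have NM: "N u \<le> max_norm J I \<phi> k" unfolding max_norm_def using finw uk by (intro Max_ge) auto
      \<comment> \<open>Strictness gives the logarithm in the denominator a negative sign, so the
        quotient inequality can be cleared.\<close>
      have "max_norm J I \<phi> k < 1"
        unfolding max_norm_def
      proof (subst Max_less_iff)
        show "\<forall>a\<in>N ` words I 1 k. a < 1"
        proof (safe)
          fix v assume v: "v \<in> words I 1 k"
          then have "length v = k" "v \<in> finite_words I" by (auto simp: words_def finite_words_def)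
          then have "N v \<le> c ^ k" using Nc by blast
          also have "\<dots> < 1" using c k(2) by (simp add: power_Suc_less_one power_less_one_iff)
          finally show "N v < 1" .
        qed
      qed (use finw uk in auto)
      then have lnM: "ln (max_norm J I \<phi> k) < 0" using Npos NM by simp
      have "h * ln (N u) \<le> h * ln (max_norm J I \<phi> k)" using Npos NM h by simp
      also have "\<dots> < ln (min_norm J I \<phi> k)" using k0[OF k(1)] lnM by (simp add: neg_divide_less_eq)
      finally have 1: "h * ln (N u) < ln (min_norm J I \<phi> k)" .
      have "\<delta> * min_norm J I \<phi> k \<le> N w * min_norm J I \<phi> k"
        using u(6) min_norm_pos[OF k(2)] by simp
      also have "\<dots> \<le> N w * sup_deriv_norm J (\<phi> k i)"
        unfolding min_norm_def using u(3) k finite_I[OF k(2)] word_norm_pos[OF u(2)]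
        by (intro mult_left_mono Min_le) auto
      also have "\<dots> \<le> C * N u" using C(2) u(1,4) k(3) by simp
      finally have "ln (\<delta> * min_norm J I \<phi> k) \<le> ln (C * N u)"
        using elim min_norm_pos[OF k(2)] C(1) Npos by simp
      then have "ln \<delta> + ln (min_norm J I \<phi> k) \<le> ln C + ln (N u)"
        using elim min_norm_pos[OF k(2)] C(1) Npos by (simp add: ln_mult)
      with 1 have "ln \<delta> - ln C \<le> (1 - h) * ln (N u)" by (simp add: algebra_simps)
      then have "(1 + e / 2) * (ln \<delta> - ln C) \<le> (1 + e / 2) * ((1 - h) * ln (N u))"
        using \<open>e > 0\<close> by (intro mult_left_mono) auto
      also have "\<dots> = ln (N u)" using eh by (metis mult.assoc mult_1)
      finally have "(1 + e / 2) * ln \<delta> - (1 + e / 2) * ln C \<le> ln (N u)"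
        by (simp only: right_diff_distrib)
      moreover have "e / 2 * ln \<delta> < - (1 + e / 2) * ln C"
        using elim(1) \<delta> by (simp only: neg_divide_less_eq)
      moreover have "(1 + e) * ln \<delta> = (1 + e / 2) * ln \<delta> + e / 2 * ln \<delta>"
        by (simp add: field_simps)
      ultimately show "(1 + e) * ln \<delta> \<le> ln (N u)" by (simp only: mult_minus_left)
    qed
  qed
qed

end

section \<open>Dimension bounds\<close>

lemma (in finite_measure) measure_eq_sum_partition:
  assumes "finite F" "A \<in> sets M" "\<And>i. i \<in> F \<Longrightarrow> P i \<in> sets M"
    and "A \<subseteq> (\<Union>i\<in>F. P i)" "disjoint_family_on P F"
  shows "measure M A = (\<Sum>i\<in>F. measure M (A \<inter> P i))"
proof -
  have "measure M (\<Union>i\<in>F. A \<inter> P i) = (\<Sum>i\<in>F. measure M (A \<inter> P i))"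
  proof (rule finite_measure_finite_Union[OF assms(1)])
    show "disjoint_family_on (\<lambda>i. A \<inter> P i) F"
      using assms(5) unfolding disjoint_family_on_def by blast
  qed (use assms in auto)
  moreover have "(\<Union>i\<in>F. A \<inter> P i) = A" using assms(4) by auto
  ultimately show ?thesis by simp
qed

context ncifs
begin

context
  fixes \<mu> :: "(nat \<Rightarrow> 'i) measure" and q :: real
  assumes sets_\<mu>: "sets \<mu> = sets (borel_words I)" and finite_\<mu>: "finite_measure \<mu>"
    and mass_pos: "measure \<mu> (inf_words I) > 0" and q: "q > 0"
    and mass_le: "q = 1 \<Longrightarrow> measure \<mu> (inf_words I) \<le> 1"
begin

lemma space_\<mu>: "space \<mu> = inf_words I"
  using sets_eq_imp_space_eq[OF sets_\<mu>] by simp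

lemma coding_measurable_\<mu>: "coding Jw \<in> measurable \<mu> borel"
  using coding_measurable measurable_cong_sets[OF sets_\<mu> refl] by blast

lemma cylinder_in_\<mu>: "cylinder I u \<in> sets \<mu>"
  by (simp add: sets_\<mu> cylinder_in_borel_words)

text \<open>Serves both bounds: stopping words with \<open>R\<close> proportional to \<delta> keep
  the cube count constant, while the single empty word with fixed \<open>R\<close> makes it of order
  \<delta>^-d.\<close>

lemma dim_quotient_le_partition:
  assumes \<delta>: "0 < \<delta>" "\<delta> < 1" and U: "finite U"
    and cover: "\<And>v. v \<in> inf_words I \<Longrightarrow> \<exists>u\<in>U. v \<in> cylinder I u"
    and disj: "\<And>u u' v. u \<in> U \<Longrightarrow> u' \<in> U \<Longrightarrow> v \<in> cylinder I u \<Longrightarrow> v \<in> cylinder I u' \<Longrightarrow> u = u'"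
    and R: "R \<ge> 0" "\<And>u x y. u \<in> U \<Longrightarrow> x \<in> Jw u \<Longrightarrow> y \<in> Jw u \<Longrightarrow> norm (x - y) \<le> R"
  shows "dim_quotient q (image_measure Jw \<mu>) \<delta> \<le>
    ereal ((log_moment q U (\<lambda>u. measure \<mu> (cylinder I u)) - DIM('a) * ln (2 * R / \<delta> + 2)) / ln \<delta>)"
proof -
  interpret finite_measure \<mu> by (rule finite_\<mu>)
  let ?\<nu> = "image_measure Jw \<mu>"
  \<comment> \<open>The image measure is carried by the bounded set \<open>J\<close>, so finitely
    many cubes matter.\<close>
  define F where "F = {Q\<in>mesh_cubes \<delta>. Q \<inter> J \<noteq> {}}"
  define P where "P Q = coding Jw -` Q \<inter> inf_words I" for Q
  define a where "a u Q = measure \<mu> (cylinder I u \<inter> P Q)" for u Q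
  define K where "K = nat \<lfloor>(2 * R / \<delta> + 2) ^ DIM('a)\<rfloor>"
  obtain B where B: "\<And>x. x \<in> J \<Longrightarrow> norm x \<le> B"
    using compact_imp_bounded[OF J(1)] by (auto simp: bounded_iff)
  have JB: "norm (x - y) \<le> 2 * B" if "x \<in> J" "y \<in> J" for x y
    using norm_triangle_ineq4[of x y] B[OF that(1)] B[OF that(2)] by linarith
  have "B \<ge> 0" using J_nonempty B norm_ge_zero by (metis ex_in_conv order_trans)
  then have F: "finite F" unfolding F_def
    by (intro mesh_cubes_meeting_bounded[OF \<delta>(1), of "2 * B"] JB) auto
  have P_sets: "P Q \<in> sets \<mu>" if "Q \<in> mesh_cubes \<delta>" for Q
    using measurable_sets[OF coding_measurable_\<mu> mesh_cubes_borel[OF that]] by (simp add: P_def space_\<mu>)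
  have \<nu>: "measure ?\<nu> Q = measure \<mu> (P Q)" if "Q \<in> mesh_cubes \<delta>" for Q
    unfolding image_measure_def
    using measure_distr[OF coding_measurable_\<mu> mesh_cubes_borel[OF that]] by (simp add: P_def space_\<mu>)
  have cyl_sub: "cylinder I u \<subseteq> inf_words I" for u by (auto simp: cylinder_def)
  have r: "measure \<mu> (cylinder I u) = (\<Sum>Q\<in>F. a u Q)" for u
    unfolding a_def
  proof (rule measure_eq_sum_partition)
    show "cylinder I u \<subseteq> (\<Union>Q\<in>F. P Q)"
    proof
      fix v assume "v \<in> cylinder I u"
      then have v: "v \<in> inf_words I" using cyl_sub by blast
      obtain Q where "Q \<in> mesh_cubes \<delta>" "coding Jw v \<in> Q" using mesh_cubes_cover[OF \<delta>(1)] by blast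
      then show "v \<in> (\<Union>Q\<in>F. P Q)" using v coding_in_J[OF v] by (auto simp: F_def P_def)
    qed
    show "disjoint_family_on P F"
      using mesh_cubes_disjoint[OF \<delta>(1)] by (fastforce simp: disjoint_family_on_def F_def P_def)
  qed (use P_sets cylinder_in_\<mu> F in \<open>auto simp: F_def\<close>)
  have s: "measure ?\<nu> Q = (\<Sum>u\<in>U. a u Q)" if Q: "Q \<in> F" for Q
  proof -
    have Qm: "Q \<in> mesh_cubes \<delta>" using Q by (simp add: F_def)
    have "measure \<mu> (P Q) = (\<Sum>u\<in>U. measure \<mu> (P Q \<inter> cylinder I u))"
    proof (rule measure_eq_sum_partition)
      show "P Q \<subseteq> (\<Union>u\<in>U. cylinder I u)" using cover by (auto simp: P_def)
      show "disjoint_family_on (cylinder I) U" using disj by (auto simp: disjoint_family_on_def)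
    qed (use P_sets[OF Qm] cylinder_in_\<mu> U in auto)
    then show ?thesis by (simp add: \<nu>[OF Qm] a_def Int_commute)
  qed
  have m: "(\<Sum>u\<in>U. measure \<mu> (cylinder I u)) = measure \<mu> (inf_words I)"
  proof -
    have "measure \<mu> (inf_words I) = (\<Sum>u\<in>U. measure \<mu> (inf_words I \<inter> cylinder I u))"
    proof (rule measure_eq_sum_partition)
      show "inf_words I \<subseteq> (\<Union>u\<in>U. cylinder I u)" using cover by auto
      show "disjoint_family_on (cylinder I) U" using disj by (auto simp: disjoint_family_on_def)
      show "inf_words I \<in> sets \<mu>" using sets.top[of \<mu>] by (simp add: space_\<mu>)
    qed (use cylinder_in_\<mu> U in auto)
    then show ?thesis using cyl_sub by (simp add: Int_absorb1)
  qed
  have X: "2 * R / \<delta> + 2 \<ge> 2" using R(1) \<delta> by simp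
  then have X1: "(2 * R / \<delta> + 2) ^ DIM('a) \<ge> 1" by (intro one_le_power) simp
  then have K: "K > 0" "real K \<le> (2 * R / \<delta> + 2) ^ DIM('a)" by (auto simp: K_def)
  have card: "card {Q\<in>F. a u Q \<noteq> 0} \<le> K" if u: "u \<in> U" for u
  proof -
    \<comment> \<open>Nonzero joint mass provides a word of the cylinder coded into Q, and its code
      lies in \<open>Jw u\<close>.\<close>
    have sub: "{Q\<in>F. a u Q \<noteq> 0} \<subseteq> {Q\<in>mesh_cubes \<delta>. Q \<inter> Jw u \<noteq> {}}"
    proof safe
      fix Q assume Q: "Q \<in> F" "a u Q \<noteq> 0" and empty: "Q \<inter> Jw u = {}"
      have "cylinder I u \<inter> P Q \<noteq> {}" using Q(2) by (auto simp: a_def)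
      then show False using coding_cylinder empty by (auto simp: P_def)
    qed (simp add: F_def)
    have "card {Q\<in>F. a u Q \<noteq> 0} \<le> card {Q\<in>mesh_cubes \<delta>. Q \<inter> Jw u \<noteq> {}}"
      by (rule card_mono[OF mesh_cubes_meeting_bounded(1)[OF \<delta>(1) R(1)] sub]) (rule R(2)[OF u])
    also have "\<dots> \<le> K"
      using mesh_cubes_meeting_bounded(2)[OF \<delta>(1) R(1), of "Jw u"] R(2)[OF u]
      by (simp add: K_def le_nat_floor)
    finally show ?thesis .
  qed
  have "log_moment q U (\<lambda>u. measure \<mu> (cylinder I u)) - ln K \<le> log_moment q F (measure ?\<nu>)"
    by (rule log_moment_compare[OF q U F K(1) _ card r s m[symmetric] mass_pos mass_le])
      (simp add: a_def)
  moreover have "ln K \<le> DIM('a) * ln (2 * R / \<delta> + 2)"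
  proof -
    have "ln K \<le> ln ((2 * R / \<delta> + 2) ^ DIM('a))" using K by simp
    then show ?thesis using X by (simp add: ln_realpow)
  qed
  ultimately have "log_moment q U (\<lambda>u. measure \<mu> (cylinder I u)) - DIM('a) * ln (2 * R / \<delta> + 2)
      \<le> log_moment q F (measure ?\<nu>)" by linarith
  moreover have ln\<delta>: "ln \<delta> < 0" using \<delta> by simp
  moreover have "dim_quotient q ?\<nu> \<delta> = ereal (log_moment q F (measure ?\<nu>) / ln \<delta>)"
  proof (rule dim_quotient_eq_log_moment[OF F])
    show "F \<subseteq> mesh_cubes \<delta>" by (auto simp: F_def)
    show "measure ?\<nu> Q = 0" if "Q \<in> mesh_cubes \<delta> - F" for Q
    proof -
      have "P Q = {}" using that coding_in_J by (auto simp: F_def P_def)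
      then show ?thesis using that \<nu> by simp
    qed
    have "(\<Sum>Q\<in>F. measure ?\<nu> Q) = (\<Sum>Q\<in>F. \<Sum>u\<in>U. a u Q)" using s by simp
    also have "\<dots> = (\<Sum>u\<in>U. measure \<mu> (cylinder I u))" unfolding r by (rule sum.swap)
    finally show "(\<Sum>Q\<in>F. measure ?\<nu> Q) > 0" using m mass_pos by simp
    show "ln \<delta> \<noteq> 0" using ln\<delta> by simp
  qed
  ultimately show ?thesis by (simp add: divide_right_mono_neg)
qed

text \<open>For the trivial partition the moment is independent of \<delta>, so only the growth
  \<delta>^-d of the number of cubes meeting \<open>J\<close> survives division by
  \<open>ln \<delta>\<close>.\<close>

lemma eventually_dim_quotient_le_DIM:
  fixes e :: real
  assumes "e > 0"
  shows "eventually (\<lambda>\<delta>. dim_quotient q (image_measure Jw \<mu>) \<delta> \<le> ereal (DIM('a) + e)) (at_right 0)"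
proof -
  obtain L where L: "L > 0" "\<forall>u\<in>finite_words I. \<forall>x\<in>Jw u. \<forall>y\<in>Jw u. norm (x - y) \<le> L * N u"
    using Jw_diameter by blast
  define B where "B = log_moment q {[]} (\<lambda>u. measure \<mu> (cylinder I u)) - DIM('a) * ln (2 * L + 2)"
  have "eventually (\<lambda>\<delta>::real. \<delta> < 1) (at_right 0)"
    by (rule order_tendstoD(2)[OF tendsto_ident_at]) simp
  then show ?thesis
    using eventually_divide_ln_small[OF assms, of B] eventually_at_right_less[of 0]
  proof eventually_elim
    case (elim \<delta>)
    then have ln\<delta>: "ln \<delta> < 0" by simp
    have "dim_quotient q (image_measure Jw \<mu>) \<delta> \<le>
      ereal ((log_moment q {[]} (\<lambda>u. measure \<mu> (cylinder I u)) - DIM('a) * ln (2 * L / \<delta> + 2)) / ln \<delta>)"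
    proof (rule dim_quotient_le_partition)
      show "norm (x - y) \<le> L" if "u \<in> {[]}" "x \<in> Jw u" "y \<in> Jw u" for u x y
        using L(2)[rule_format, of "[]" x y] that by (simp add: word_norm_Nil)
    qed (use elim L(1) in \<open>auto simp: cylinder_def\<close>)
    also have "(log_moment q {[]} (\<lambda>u. measure \<mu> (cylinder I u)) - DIM('a) * ln (2 * L / \<delta> + 2)) / ln \<delta>
        \<le> (B + DIM('a) * ln \<delta>) / ln \<delta>"
    proof (rule divide_right_mono_neg)
      \<comment> \<open>As \<delta> < 1, 2 is at most 2/\<delta>, which isolates the factor
        1/\<delta>.\<close>
      have "ln (2 * L / \<delta> + 2) \<le> ln ((2 * L + 2) / \<delta>)"
        using elim L(1) by (subst ln_le_cancel_iff) (auto simp: field_simps)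
      also have "\<dots> = ln (2 * L + 2) - ln \<delta>" using elim L(1) by (simp add: ln_div)
      finally have "DIM('a) * ln (2 * L / \<delta> + 2) \<le> DIM('a) * (ln (2 * L + 2) - ln \<delta>)"
        by (intro mult_left_mono) auto
      then show "B + DIM('a) * ln \<delta> \<le>
          log_moment q {[]} (\<lambda>u. measure \<mu> (cylinder I u)) - DIM('a) * ln (2 * L / \<delta> + 2)"
        by (simp add: B_def right_diff_distrib)
    qed (use ln\<delta> in simp)
    also have "(B + DIM('a) * ln \<delta>) / ln \<delta> \<le> DIM('a) + e"
      using elim ln\<delta> by (simp add: add_divide_distrib)
    finally show ?case by simp
  qed
qed

lemma eventually_dim_quotient_le_of_pressure_neg:
  assumes H: "(\<lambda>k. ln (min_norm J I \<phi> k) / ln (max_norm J I \<phi> k)) \<longlonglongrightarrow> 0" and "e > 0"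
  shows "eventually (\<lambda>\<delta>. pressure_quotient J I \<phi> \<mu> t q \<delta> < 0 \<longrightarrow>
    dim_quotient q (image_measure Jw \<mu>) \<delta> \<le> ereal (t + e)) (at_right 0)"
proof -
  interpret finite_measure \<mu> by (rule finite_\<mu>)
  obtain L where L: "L > 0" "\<forall>u\<in>finite_words I. \<forall>x\<in>Jw u. \<forall>y\<in>Jw u. norm (x - y) \<le> L * N u"
    using Jw_diameter by blast
  \<comment> \<open>For pieces of diameter at most \<open>L * \<delta>\<close> the count 2 L
    \<delta> / \<delta> + 2 per coordinate does not depend on \<delta>.\<close>
  define B where "B = - (DIM('a) * ln (2 * L + 2))"
  \<comment> \<open>Half of e pays for the spread of \<open>ln (N u)\<close>, half for
    \<open>B\<close>; the added 1 covers t = 0.\<close>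
  define h where "h = e / (2 * (\<bar>t\<bar> + 1))"
  have h: "h > 0" "h * \<bar>t\<bar> \<le> e / 2" using \<open>e > 0\<close> by (auto simp: h_def field_simps)
  have "eventually (\<lambda>\<delta>::real. \<delta> < 1) (at_right 0)"
    by (rule order_tendstoD(2)[OF tendsto_ident_at]) simp
  moreover have "eventually (\<lambda>\<delta>. B / ln \<delta> < e / 2) (at_right 0)"
    by (rule eventually_divide_ln_small) (use \<open>e > 0\<close> in simp)
  ultimately show ?thesis
    using eventually_stopping_norm_lower[OF H h(1)] eventually_at_right_less[of 0]
  proof eventually_elim
    case (elim \<delta>)
    then have ln\<delta>: "ln \<delta> < 0" by simp
    let ?U = "stopping_words J I \<phi> \<delta>" and ?p = "\<lambda>u. measure \<mu> (cylinder I u)"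
    have fw: "u \<in> finite_words I" "N u \<le> \<delta>" if "u \<in> ?U" for u using that by (auto simp: stopping_words_def)
    have le: "dim_quotient q (image_measure Jw \<mu>) \<delta> \<le>
      ereal ((log_moment q ?U ?p - DIM('a) * ln (2 * (L * \<delta>) / \<delta> + 2)) / ln \<delta>)"
    proof (rule dim_quotient_le_partition)
      show "norm (x - y) \<le> L * \<delta>" if u: "u \<in> ?U" and xy: "x \<in> Jw u" "y \<in> Jw u" for u x y
      proof -
        have "norm (x - y) \<le> L * N u" using L(2) fw[OF u] xy by blast
        also have "\<dots> \<le> L * \<delta>" using fw[OF u] L(1) by simp
        finally show ?thesis .
      qed
    qed (use elim L(1) finite_stopping_words stopping_words_cover stopping_words_disjoint in auto)
    have fin: "finite ?U" by (rule finite_stopping_words) (use elim in simp)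
    have m: "(\<Sum>u\<in>?U. ?p u) = measure \<mu> (inf_words I)"
    proof -
      have "measure \<mu> (inf_words I) = (\<Sum>u\<in>?U. measure \<mu> (inf_words I \<inter> cylinder I u))"
      proof (rule measure_eq_sum_partition)
        show "inf_words I \<subseteq> (\<Union>u\<in>?U. cylinder I u)" using stopping_words_cover elim by blast
        show "disjoint_family_on (cylinder I) ?U"
          using stopping_words_disjoint by (auto simp: disjoint_family_on_def)
        show "inf_words I \<in> sets \<mu>" using sets.top[of \<mu>] by (simp add: space_\<mu>)
      qed (use cylinder_in_\<mu> fin in auto)
      moreover have "inf_words I \<inter> cylinder I u = cylinder I u" for u by (auto simp: cylinder_def)
      ultimately show ?thesis by simp
    qed
    show ?case
    proof
      assume neg: "pressure_quotient J I \<phi> \<mu> t q \<delta> < 0"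
      have "(t + h * \<bar>t\<bar>) * ln \<delta> \<le> log_moment q ?U ?p"
      proof (rule log_moment_ge_of_pressure_neg[where n = N])
        \<comment> \<open>Division by 0 yields 0, so a negative quotient forces
          \<open>min_length\<close> to be positive, and cancelling it keeps the sign.\<close>
        show "(if q = 1 then - (\<Sum>u\<in>?U. ?p u * ln (N u powr (- t) * ?p u))
            else sgn (1 - q) * ln (\<Sum>u\<in>?U. N u powr (t * (1 - q)) * ?p u powr q)) < 0"
          using neg
          by (auto simp: pressure_quotient_def mult_less_0_iff zero_less_mult_iff divide_less_0_iff zero_less_divide_iff
              split: if_splits)
        show "ln (N u) \<le> ln \<delta>" if "u \<in> ?U" for u using fw[OF that] word_norm_pos elim by simp
      qed (use fin m mass_pos mass_le fw word_norm_pos elim ln\<delta> h in \<open>auto simp: measure_nonneg\<close>)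
      then have "(log_moment q ?U ?p + B) / ln \<delta> \<le> ((t + h * \<bar>t\<bar>) * ln \<delta> + B) / ln \<delta>"
        using ln\<delta> by (intro divide_right_mono_neg) auto
      also have "\<dots> = t + h * \<bar>t\<bar> + B / ln \<delta>" using ln\<delta> by (simp add: add_divide_distrib)
      also have "\<dots> \<le> t + e" using elim(2) h(2) by linarith
      finally show "dim_quotient q (image_measure Jw \<mu>) \<delta> \<le> ereal (t + e)"
        using le elim by (simp add: B_def order_trans)
    qed
  qed
qed

end

end

text \<open>Each real t of negative pressure bounds the dimension, and a jump point is the infimum
  of such t. If there is none, the infimum is \<infinity> and the minimum is d.\<close>

theorem theorem1p1:
  fixes J V :: "'a::euclidean_space set"
    and I :: "nat \<Rightarrow> 'i set"
    and \<phi> :: "nat \<Rightarrow> 'i \<Rightarrow> 'a \<Rightarrow> 'a"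
    and Jw :: "'i list \<Rightarrow> 'a set"
    and \<mu> :: "(nat \<Rightarrow> 'i) measure"
    and q :: real
  assumes "ncifs J I \<phi> Jw V"
    and "(\<lambda>k. ln (min_norm J I \<phi> k) / ln (max_norm J I \<phi> k)) \<longlonglongrightarrow> 0"
    and "sets \<mu> = sets (borel_words I)"
    and "finite_measure \<mu>"
    and "measure \<mu> (inf_words I) > 0"
    and "q > 0"
    and "q = 1 \<Longrightarrow> measure \<mu> (inf_words I) \<le> 1"
  shows "lower_dim q (image_measure Jw \<mu>) \<le> min (lower_jump J I \<phi> \<mu> q) (ereal (real DIM('a)))
    \<and> upper_dim q (image_measure Jw \<mu>) \<le> min (upper_jump J I \<phi> \<mu> q) (ereal (real DIM('a)))"
proof -
  interpret ncifs J I \<phi> Jw V by (rule assms(1))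
  let ?D = "dim_quotient q (image_measure Jw \<mu>)"
  note jump = Liminf_Limsup_le_of_neg[OF
      eventually_dim_quotient_le_of_pressure_neg[OF assms(3-7) assms(2)]]
  have lj: "lower_dim q (image_measure Jw \<mu>) \<le> lower_jump J I \<phi> \<mu> q"
    unfolding lower_dim_def lower_jump_def lower_pressure_def
    by (rule Inf_greatest) (use jump(1) in blast)
  have uj: "upper_dim q (image_measure Jw \<mu>) \<le> upper_jump J I \<phi> \<mu> q"
    unfolding upper_dim_def upper_jump_def upper_pressure_def
    by (rule Inf_greatest) (use jump(2) in blast)
  have ud: "upper_dim q (image_measure Jw \<mu>) \<le> ereal (real DIM('a))"
    unfolding upper_dim_def
  proof (rule ereal_le_epsilon2)
    fix e :: real assume "e > 0"
    then show "Limsup (at_right 0) ?D \<le> ereal (real DIM('a)) + ereal e"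
      using eventually_dim_quotient_le_DIM[OF assms(3-7)] by (simp add: Limsup_bounded)
  qed
  \<comment> \<open>The filter at 0 is nontrivial, so the bound by d passes from the upper to the
    lower dimension.\<close>
  have "lower_dim q (image_measure Jw \<mu>) \<le> upper_dim q (image_measure Jw \<mu>)"
    unfolding lower_dim_def upper_dim_def by (rule Liminf_le_Limsup) simp
  with lj uj ud show ?thesis by auto
qed

end
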